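(* Let $\hat T>0$, $\hat I=[0,\hat T]$, $\tau_g$ a real constant, $0<r<R$, and let $$x_L\in(C^2\cap W^{2,\infty})([0,\hat T];\mathbb{R}^2),\qquad \mathcal{W},\mathcal{I},\mathcal{S}\in C_c^2(\mathbb{R};\mathbb{R}),\qquad \eta\in C_c^3(\mathbb{R}^2;\mathbb{R}),$$ with $\int_{\mathbb{R}^2}\eta\,dx=1$, $\mathcal{W}'(0)=\mathcal{I}'(0)=0$, $\mathcal{S}(\xi)=1$ for $\xi\in[0,r]$ and $\mathcal{S}(\xi)=0$ for $\xi\ge R$. Set $$w(t,x)=\mathcal{W}(\|x-x_L(t)\|),\quad i(t,x)=\mathcal{I}(\|x-x_L(t)\|),\quad \mathcal{T}_g(t,x)=\tau_g\,\mathcal{S}(\|x-x_L(t)\|).$$ Consider the system in the unknowns $h_m,h_s$ (functions of $(t,x)\in\hat I\times\mathbb{R}^2$), with $H=h_s+h_m$, $$\left\{\begin{array}{l}\displaystyle\partial_t h_m+\mathrm{div}_x\left[\frac{-\left(w(t,x)h_m-\mathcal{T}_g(t,x)(h_m)^2\right)\mathrm{grad}_x(\eta*H)}{\sqrt{1+\|\mathrm{grad}_x(\eta*H)\|^2}}\right]=\frac{i(t,x)}{1+\|\mathrm{grad}_x(\eta*H)\|^2}\\[12pt]\displaystyle\partial_t h_s=-\frac{i(t,x)}{1+\|\mathrm{grad}_x(\eta*H)\|^2}.\end{array}\right.$$ Then this system is of the form $$\partial_t u_j+\mathrm{div}_x\,\phi_j(t,x,u_j,\vartheta*u)=\Phi_j(t,x,u_j,\vartheta*u),\qquad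 j=1,\dots,n,$$ with $N=n=m=2$, $u_1=h_m$, $u_2=h_s$, $$\vartheta(x)=\begin{bmatrix}\partial_{x_1}\eta(x)&\partial_{x_1}\eta(x)\\ \partial_{x_2}\eta(x)&\partial_{x_2}\eta(x)\end{bmatrix},$$ $$\phi_1(t,x,u_1,A)=\left(w(t,x)-\mathcal{T}_g(t,x)\,u_1\right)\frac{-u_1\,A}{\sqrt{1+\|A\|^2}},\qquad\phi_2(t,x,u_2,A)=0,$$ $$\Phi_1(t,x,u,A)=\frac{i(t,x)}{1+\|A\|^2},\qquad\Phi_2(t,x,u,A)=-\frac{i(t,x)}{1+\|A\|^2}.$$ Moreover, the functions $\phi=(\phi_1,\phi_2)$, $\Phi=(\Phi_1,\Phi_2)$ and $\vartheta$ satisfy the assumptions ($\phi$), ($\Phi$), ($\vartheta$) recalled in the context, for a suitable function $\lambda$ as described there.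
   Context: Notation. $x=(x_1,x_2)\in\mathbb{R}^2$; $\|\cdot\|$ is the Euclidean norm; convolutions are in the space variable only, with $(\vartheta*u(t))(x)=\int_{\mathbb{R}^N}\vartheta(x-\xi)u(t,\xi)\,d\xi\in\mathbb{R}^m$. $\mathrm{grad}_x$, $\mathrm{div}_x$ refer to the $x$ variable and $\mathrm{grad}_A$ to $A\in\mathbb{R}^m$. In the assumptions below the derivatives in $x$ are partial, at fixed $t,u,A$; $\phi(t,x,u,A)$ with scalar $u$ denotes the $n\times N$ matrix with rows $\phi_j(t,x,u,A)$, $\mathrm{div}_x\phi=(\mathrm{div}_x\phi_1,\dots,\mathrm{div}_x\phi_n)$, and $\Phi(t,x,u,A)=(\Phi_j(t,x,u,A))_j\in\mathbb{R}^n$. For $U>0$, $\mathcal{U}_U=[-U,U]$. Assumptions. There exists a continuous $\lambda:\hat I\times\mathbb{R}^N\times\mathbb{R}^+\to\mathbb{R}^+$ with $\lambda(\cdot,\cdot,U)\in L^1(\hat I\times\mathbb{R}^N;\mathbb{R})$ for every $U>0$ such that: ($\phi$) for any $U>0$, $\phi\in(C^2\cap W^{2,\infty})(\hat I\times\mathbb{R}^N\times\mathcal{U}_U\times\mathcal{U}_U^m;\mathbb{R}^{n\times N})$ and for all $(t,x,u,A)\in\hat I\times\mathbb{R}^N\times\mathcal{U}_U\times\mathcal{U}_U^m$ each of $\|\mathrm{grad}_x\phi\|$, $\|\mathrm{div}_x\phi\|$, $\|\mathrm{grad}_x\mathrm{div}_x\phi\|$, $\|\mathrm{grad}_x\mathrm{grad}_A\phi\|$,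 $\|\mathrm{grad}_A\phi\|$, $\|\mathrm{grad}_A^2\phi\|$ at $(t,x,u,A)$ is at most $\lambda(t,x,U)$; ($\Phi$) for any $U>0$, $\Phi\in(C^1\cap W^{1,\infty})(\hat I\times\mathbb{R}^N\times\mathcal{U}_U\times\mathcal{U}_U^m;\mathbb{R}^n)$ and for all $(t,x,u,A)$ in that set $\max\{\|\Phi(t,x,u,A)\|,\|\mathrm{grad}_x\Phi(t,x,u,A)\|\}\le\lambda(t,x,U)$; ($\vartheta$) $\vartheta\in C_c^2(\mathbb{R}^N;\mathbb{R}^{m\times n})$. *)

theory Defs
  imports "HOL-Analysis.Analysis"
begin

section \<open>Function spaces\<close>

text \<open>
  Derivatives are taken within the set on which the function is considered, hence are one-sided
  at its boundary. Below, the sets are products of nondegenerate intervals, where the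
  derivative within the set is unique.
\<close>

primrec Ck_on :: "nat \<Rightarrow> 'a::euclidean_space set \<Rightarrow> ('a \<Rightarrow> 'b::real_normed_vector) \<Rightarrow> bool" where
  "Ck_on 0 S f \<longleftrightarrow> continuous_on S f"
| "Ck_on (Suc k) S f \<longleftrightarrow>
     (\<forall>x\<in>S. f differentiable (at x within S)) \<and>
     (\<forall>b\<in>Basis. Ck_on k S (\<lambda>x. frechet_derivative f (at x within S) b))"

primrec bounded_derivs_on ::
  "nat \<Rightarrow> 'a::euclidean_space set \<Rightarrow> ('a \<Rightarrow> 'b::real_normed_vector) \<Rightarrow> bool" where
  "bounded_derivs_on 0 S f \<longleftrightarrow> bounded (f ` S)"
| "bounded_derivs_on (Suc k) S f \<longleftrightarrow>
     bounded (f ` S) \<and>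
     (\<forall>b\<in>Basis. bounded_derivs_on k S (\<lambda>x. frechet_derivative f (at x within S) b))"

text \<open>
  The space \<open>C\<^sup>k \<inter> W\<^sup>k\<^sup>,\<^sup>\<infinity>\<close>: the weak derivatives of order at most \<open>k\<close> of a \<open>C\<^sup>k\<close> function are
  its classical ones, and for these continuous functions being in \<open>L\<^sup>\<infinity>\<close> means being bounded.
\<close>

definition CWk_on :: "nat \<Rightarrow> 'a::euclidean_space set \<Rightarrow> ('a \<Rightarrow> 'b::real_normed_vector) \<Rightarrow> bool" where
  "CWk_on k S f \<longleftrightarrow> Ck_on k S f \<and> bounded_derivs_on k S f"

definition Ck_compact_support ::
  "nat \<Rightarrow> ('a::euclidean_space \<Rightarrow> 'b::real_normed_vector) \<Rightarrow> bool" where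
  "Ck_compact_support k f \<longleftrightarrow> Ck_on k UNIV f \<and> compact (closure {x. f x \<noteq> 0})"

definition locally_integrable :: "('a::euclidean_space \<Rightarrow> real) \<Rightarrow> bool" where
  "locally_integrable f \<longleftrightarrow> (\<forall>K. compact K \<longrightarrow> f absolutely_integrable_on K)"


section \<open>Gradient, divergence and convolution\<close>

text \<open>
  The outermost index of the gradient is the direction of differentiation. As the values may
  themselves be vectors, matrices, \dots, gradients can be iterated; the norm of the resulting
  tensor is the Euclidean norm of all its entries.
\<close>

definition grad_on :: "(real^'k) set \<Rightarrow> (real^'k \<Rightarrow> 'b::real_normed_vector) \<Rightarrow> real^'k \<Rightarrow> 'b^'k" where
  "grad_on S f x = (\<chi> k. frechet_derivative f (at x within S) (axis k 1))"

abbreviation grad :: "(real^'k \<Rightarrow> 'b::real_normed_vector) \<Rightarrow> real^'k \<Rightarrow> 'b^'k" where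
  "grad \<equiv> grad_on UNIV"

definition divergence :: "(real^'k \<Rightarrow> real^'k) \<Rightarrow> real^'k \<Rightarrow> real" where
  "divergence f x = (\<Sum>k\<in>UNIV. frechet_derivative f (at x) (axis k 1) $ k)"

definition conv :: "(real^'N \<Rightarrow> real) \<Rightarrow> (real^'N \<Rightarrow> real) \<Rightarrow> real^'N \<Rightarrow> real" where
  "conv \<eta> f x = (LINT \<xi>|lebesgue. \<eta> (x - \<xi>) * f \<xi>)"

definition mconv :: "(real^'N \<Rightarrow> real^'n^'m) \<Rightarrow> (real^'N \<Rightarrow> real^'n) \<Rightarrow> real^'N \<Rightarrow> real^'m" where
  "mconv \<theta> v x = (LINT \<xi>|lebesgue. \<theta> (x - \<xi>) *v v \<xi>)"


section \<open>Nonlocal systems of balance laws\<close>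

text \<open>The equation \<open>\<partial>\<^sub>t h + div\<^sub>x P = g\<close> on \<open>[0, T] \<times> \<real>\<^sup>N\<close>, in the classical sense.\<close>

definition balance_law ::
  "real \<Rightarrow> (real \<Rightarrow> real^'N \<Rightarrow> real) \<Rightarrow> (real \<Rightarrow> real^'N \<Rightarrow> real^'N) \<Rightarrow> (real \<Rightarrow> real^'N \<Rightarrow> real) \<Rightarrow> bool"
where
  "balance_law T h P g \<longleftrightarrow>
     (\<forall>t\<in>{0..T}. \<forall>x. P t differentiable (at x) \<and>
        (\<exists>a. ((\<lambda>s. h s x) has_real_derivative a) (at t within {0..T}) \<and>
             a + divergence (P t) x = g t x))"

definition nonlocal_balance_system ::
  "real \<Rightarrow> (real \<Rightarrow> real^'N \<Rightarrow> real \<Rightarrow> real^'m \<Rightarrow> real^'N^'n) \<Rightarrow>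
   (real \<Rightarrow> real^'N \<Rightarrow> real \<Rightarrow> real^'m \<Rightarrow> real^'n) \<Rightarrow> (real^'N \<Rightarrow> real^'n^'m) \<Rightarrow>
   (real \<Rightarrow> real^'N \<Rightarrow> real^'n) \<Rightarrow> bool"
where
  "nonlocal_balance_system T \<phi> \<Phi> \<theta> u \<longleftrightarrow>
     (\<forall>j. balance_law T (\<lambda>t x. u t x $ j)
            (\<lambda>t x. \<phi> t x (u t x $ j) (mconv \<theta> (u t) x) $ j)
            (\<lambda>t x. \<Phi> t x (u t x $ j) (mconv \<theta> (u t) x) $ j))"

definition param_box :: "real \<Rightarrow> (real^'m) set" where
  "param_box U = {A. \<forall>k. A $ k \<in> {-U..U}}"

definition coeff_domain :: "real \<Rightarrow> real \<Rightarrow> (real \<times> (real^'N) \<times> real \<times> (real^'m)) set" where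
  "coeff_domain T U = {0..T} \<times> UNIV \<times> {-U..U} \<times> param_box U"

definition admissible_bound :: "real \<Rightarrow> (real \<Rightarrow> real^'N \<Rightarrow> real \<Rightarrow> real) \<Rightarrow> bool" where
  "admissible_bound T lam \<longleftrightarrow>
     continuous_on ({0..T} \<times> UNIV \<times> {0..}) (\<lambda>(t, x, U). lam t x U) \<and>
     (\<forall>t\<in>{0..T}. \<forall>x. \<forall>U\<ge>0. lam t x U \<ge> 0) \<and>
     (\<forall>U>0. (\<lambda>(t, x). lam t x U) absolutely_integrable_on ({0..T} \<times> UNIV))"

definition div_rows :: "(real^'N \<Rightarrow> real^'N^'n) \<Rightarrow> real^'N \<Rightarrow> real^'n" where
  "div_rows M x = (\<chi> j. divergence (\<lambda>y. M y $ j) x)"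

definition flux_assumption ::
  "real \<Rightarrow> (real \<Rightarrow> real^'N \<Rightarrow> real \<Rightarrow> real) \<Rightarrow>
   (real \<Rightarrow> real^'N \<Rightarrow> real \<Rightarrow> real^'m \<Rightarrow> real^'N^'n) \<Rightarrow> bool"
where
  "flux_assumption T lam \<phi> \<longleftrightarrow>
     (\<forall>U>0. CWk_on 2 (coeff_domain T U) (\<lambda>(t, x, u, A). \<phi> t x u A) \<and>
       (\<forall>(t, x, u, A)\<in>coeff_domain T U.
          norm (grad (\<lambda>y. \<phi> t y u A) x) \<le> lam t x U \<and>
          norm (div_rows (\<lambda>y. \<phi> t y u A) x) \<le> lam t x U \<and>
          norm (grad (div_rows (\<lambda>y. \<phi> t y u A)) x) \<le> lam t x U \<and>
          norm (grad (\<lambda>y. grad_on (param_box U) (\<phi> t y u) A) x) \<le> lam t x U \<and>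
          norm (grad_on (param_box U) (\<phi> t x u) A) \<le> lam t x U \<and>
          norm (grad_on (param_box U) (grad_on (param_box U) (\<phi> t x u)) A) \<le> lam t x U))"

definition source_assumption ::
  "real \<Rightarrow> (real \<Rightarrow> real^'N \<Rightarrow> real \<Rightarrow> real) \<Rightarrow>
   (real \<Rightarrow> real^'N \<Rightarrow> real \<Rightarrow> real^'m \<Rightarrow> real^'n) \<Rightarrow> bool"
where
  "source_assumption T lam \<Phi> \<longleftrightarrow>
     (\<forall>U>0. CWk_on 1 (coeff_domain T U) (\<lambda>(t, x, u, A). \<Phi> t x u A) \<and>
       (\<forall>(t, x, u, A)\<in>coeff_domain T U.
          max (norm (\<Phi> t x u A)) (norm (grad (\<lambda>y. \<Phi> t y u A) x)) \<le> lam t x U))"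

definition kernel_assumption :: "(real^'N \<Rightarrow> real^'n^'m) \<Rightarrow> bool" where
  "kernel_assumption \<theta> \<longleftrightarrow> Ck_compact_support 2 \<theta>"


section \<open>The laser cutting system\<close>

definition height_grad ::
  "(real^2 \<Rightarrow> real) \<Rightarrow> (real \<Rightarrow> real^2 \<Rightarrow> real) \<Rightarrow> (real \<Rightarrow> real^2 \<Rightarrow> real) \<Rightarrow> real \<Rightarrow> real^2 \<Rightarrow> real^2"
where
  "height_grad \<eta> hm hs t = grad (conv \<eta> (\<lambda>\<xi>. hs t \<xi> + hm t \<xi>))"

definition melt_flux ::
  "(real \<Rightarrow> real^2 \<Rightarrow> real) \<Rightarrow> (real \<Rightarrow> real^2 \<Rightarrow> real) \<Rightarrow> (real^2 \<Rightarrow> real) \<Rightarrow>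
   (real \<Rightarrow> real^2 \<Rightarrow> real) \<Rightarrow> (real \<Rightarrow> real^2 \<Rightarrow> real) \<Rightarrow> real \<Rightarrow> real^2 \<Rightarrow> real^2"
where
  "melt_flux w Tg \<eta> hm hs t x =
     (- (w t x * hm t x - Tg t x * (hm t x)\<^sup>2) / sqrt (1 + (norm (height_grad \<eta> hm hs t x))\<^sup>2))
       *\<^sub>R height_grad \<eta> hm hs t x"

definition melt_source ::
  "(real \<Rightarrow> real^2 \<Rightarrow> real) \<Rightarrow> (real^2 \<Rightarrow> real) \<Rightarrow>
   (real \<Rightarrow> real^2 \<Rightarrow> real) \<Rightarrow> (real \<Rightarrow> real^2 \<Rightarrow> real) \<Rightarrow> real \<Rightarrow> real^2 \<Rightarrow> real"
where
  "melt_source i \<eta> hm hs t x = i t x / (1 + (norm (height_grad \<eta> hm hs t x))\<^sup>2)"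

definition laser_system ::
  "real \<Rightarrow> (real \<Rightarrow> real^2 \<Rightarrow> real) \<Rightarrow> (real \<Rightarrow> real^2 \<Rightarrow> real) \<Rightarrow> (real \<Rightarrow> real^2 \<Rightarrow> real) \<Rightarrow>
   (real^2 \<Rightarrow> real) \<Rightarrow> (real \<Rightarrow> real^2 \<Rightarrow> real) \<Rightarrow> (real \<Rightarrow> real^2 \<Rightarrow> real) \<Rightarrow> bool"
where
  "laser_system T w i Tg \<eta> hm hs \<longleftrightarrow>
     balance_law T hm (melt_flux w Tg \<eta> hm hs) (melt_source i \<eta> hm hs) \<and>
     (\<forall>t\<in>{0..T}. \<forall>x.
        ((\<lambda>s. hs s x) has_real_derivative - melt_source i \<eta> hm hs t x) (at t within {0..T}))"

definition laser_kernel :: "(real^2 \<Rightarrow> real) \<Rightarrow> real^2 \<Rightarrow> real^2^2" where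
  "laser_kernel \<eta> x =
     vector [vector [grad \<eta> x $ 1, grad \<eta> x $ 1],
             vector [grad \<eta> x $ 2, grad \<eta> x $ 2]]"

definition laser_flux ::
  "(real \<Rightarrow> real^2 \<Rightarrow> real) \<Rightarrow> (real \<Rightarrow> real^2 \<Rightarrow> real) \<Rightarrow>
   real \<Rightarrow> real^2 \<Rightarrow> real \<Rightarrow> real^2 \<Rightarrow> real^2^2"
where
  "laser_flux w Tg t x u A =
     vector [((w t x - Tg t x * u) * (- u / sqrt (1 + (norm A)\<^sup>2))) *\<^sub>R A, 0]"

definition laser_source ::
  "(real \<Rightarrow> real^2 \<Rightarrow> real) \<Rightarrow> real \<Rightarrow> real^2 \<Rightarrow> real \<Rightarrow> real^2 \<Rightarrow> real^2"
where
  "laser_source i t x u A =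
     vector [i t x / (1 + (norm A)\<^sup>2), - i t x / (1 + (norm A)\<^sup>2)]"

end

theory Submission
  imports Defs
begin

text \<open>
  Three observations make the laser cutting system an instance of the abstract nonlocal system.

  First, differentiation commutes with convolution: the gradient of \<open>\<eta> * H\<close> is the convolution of the
  gradient of \<open>\<eta>\<close> with \<open>H = h\<^sub>s + h\<^sub>m\<close>, which is the vector \<open>\<theta> * u\<close> for the given kernel
  (\<open>mconv_laser_kernel\<close>). The unknowns are merely locally integrable; this is enough because \<open>\<eta>\<close> has
  compact support and bounded second derivatives, so that its first order Taylor remainder is
  quadratic uniformly in the base point (\<open>conv_has_derivative\<close>). The equations then agree term by
  term (\<open>laser_balance_iff\<close>).

  Secondly, the flux has separated variables: it is
  \<open>(- u w(t, x) + u\<^sup>2 T\<^sub>g(t, x)) A / sqrt (1 + \<parallel>A\<parallel>\<^sup>2)\<close>, and similarly for the source. The vector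
  \<open>A / sqrt (1 + \<parallel>A\<parallel>\<^sup>2)\<close> and the scalar \<open>1 / sqrt (1 + \<parallel>A\<parallel>\<^sup>2)\<close> have derivatives that are polynomials in
  the two functions themselves, so all their derivatives are bounded on the whole space
  (\<open>CWk_on_normal_components\<close>).

  Thirdly, \<open>w\<close>, \<open>i\<close> and \<open>T\<^sub>g\<close> are radial profiles transported along the bounded curve \<open>x\<^sub>L\<close>. A radial
  profile whose one-dimensional derivative vanishes at \<open>0\<close> is of class \<open>C\<^sup>2\<close> at the centre as well
  (\<open>Ck_compact_support_radial\<close>), and by compactness of the supports all three functions vanish outside
  one ball of \<open>\<real>\<^sup>2\<close>, for all times. Hence every quantity that has to be bounded is at most
  \<open>K (1 + U + U\<^sup>2) \<chi>(x)\<close> with a continuous cut-off \<open>\<chi>\<close> of compact support, and this function is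
  admissible (\<open>flux_assumption_laser_flux\<close>, \<open>source_assumption_laser_source\<close>,
  \<open>admissible_bound_cutoff\<close>).
\<close>

section \<open>Sets on which one-sided derivatives are unique\<close>

text \<open>
  Along every coordinate axis, each point of the set is a limit of other points of the set. This is
  what makes the derivative within the set unique, also at the faces and corners of a box, and it
  is stable under products. Without uniqueness \<^const>\<open>frechet_derivative\<close> would not
  obey the sum, product and chain rules.
\<close>

definition axis_accessible :: "'a::euclidean_space set \<Rightarrow> bool" where
  "axis_accessible S \<longleftrightarrow>
     (\<forall>x\<in>S. \<forall>b\<in>Basis. \<forall>e>0. \<exists>d. 0 < \<bar>d\<bar> \<and> \<bar>d\<bar> < e \<and> x + d *\<^sub>R b \<in> S)"

lemma axis_accessible_UNIV [simp]: "axis_accessible (UNIV :: 'a::euclidean_space set)"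
  unfolding axis_accessible_def
proof (intro ballI allI impI)
  fix x b :: 'a and e :: real assume "e > 0"
  then show "\<exists>d. 0 < \<bar>d\<bar> \<and> \<bar>d\<bar> < e \<and> x + d *\<^sub>R b \<in> UNIV"
    by (intro exI[of _ "e / 2"]) auto
qed

lemma axis_accessible_cbox:
  fixes a b :: "'a::euclidean_space"
  assumes "\<And>i. i \<in> Basis \<Longrightarrow> a \<bullet> i < b \<bullet> i"
  shows "axis_accessible (cbox a b)"
  unfolding axis_accessible_def
proof (intro ballI allI impI)
  fix x i :: 'a and e :: real
  assume x: "x \<in> cbox a b" and i: "i \<in> Basis" and e: "e > 0"
  show "\<exists>d. 0 < \<bar>d\<bar> \<and> \<bar>d\<bar> < e \<and> x + d *\<^sub>R i \<in> cbox a b"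
  proof (cases "x \<bullet> i < b \<bullet> i")
    case True
    then show ?thesis
      using e x i
      by (intro exI[of _ "min (b \<bullet> i - x \<bullet> i) e / 2"])
         (auto simp: mem_box field_simps inner_simps inner_Basis)
  next
    case False
    then have "a \<bullet> i < x \<bullet> i" using assms[OF i] by linarith
    then show ?thesis
      using e x i
      by (intro exI[of _ "- (min (x \<bullet> i - a \<bullet> i) e / 2)"])
         (auto simp: mem_box field_simps inner_simps inner_Basis)
  qed
qed

lemma axis_accessible_Times:
  assumes "axis_accessible S" "axis_accessible T"
  shows "axis_accessible (S \<times> T)"
  unfolding axis_accessible_def
proof (intro ballI allI impI)
  fix p b and e :: real
  assume p: "p \<in> S \<times> T" and b: "b \<in> (Basis :: ('a \<times> 'b) set)" and e: "e > 0"
  from b consider c where "c \<in> Basis" "b = (c, 0)" | c where "c \<in> Basis" "b = (0, c)"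
    by (auto simp: Basis_prod_def)
  then show "\<exists>d. 0 < \<bar>d\<bar> \<and> \<bar>d\<bar> < e \<and> p + d *\<^sub>R b \<in> S \<times> T"
  proof cases
    case 1
    with assms(1) p e obtain d where "0 < \<bar>d\<bar>" "\<bar>d\<bar> < e" "fst p + d *\<^sub>R c \<in> S"
      unfolding axis_accessible_def by (metis mem_Times_iff)
    with 1 p show ?thesis by (intro exI[of _ d]) (auto simp: mem_Times_iff)
  next
    case 2
    with assms(2) p e obtain d where "0 < \<bar>d\<bar>" "\<bar>d\<bar> < e" "snd p + d *\<^sub>R c \<in> T"
      unfolding axis_accessible_def by (metis mem_Times_iff)
    with 2 p show ?thesis by (intro exI[of _ d]) (auto simp: mem_Times_iff)
  qed
qed

abbreviation dir_deriv ::
  "'a::euclidean_space set \<Rightarrow> 'a \<Rightarrow> ('a \<Rightarrow> 'b::real_normed_vector) \<Rightarrow> 'a \<Rightarrow> 'b" where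
  "dir_deriv S b f x \<equiv> frechet_derivative f (at x within S) b"

lemma frechet_derivative_within_eq:
  fixes f :: "'a::euclidean_space \<Rightarrow> 'b::real_normed_vector"
  assumes "axis_accessible S" "x \<in> S" "(f has_derivative D) (at x within S)"
  shows "frechet_derivative f (at x within S) = D"
proof (rule frechet_derivative_unique_within[OF _ assms(3)])
  show "(f has_derivative frechet_derivative f (at x within S)) (at x within S)"
    using assms(3) by (metis differentiableI frechet_derivative_works)
qed (use assms(1,2) in \<open>auto simp: axis_accessible_def\<close>)

lemma frechet_derivative_within_cong:
  assumes "x \<in> S" "\<And>y. y \<in> S \<Longrightarrow> f y = g y"
  shows "frechet_derivative f (at x within S) = frechet_derivative g (at x within S)"
proof -
  have "(f has_derivative D) (at x within S) \<longleftrightarrow> (g has_derivative D) (at x within S)" for D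
    using assms has_derivative_transform[of x S f g] has_derivative_transform[of x S g f] by metis
  then show ?thesis unfolding frechet_derivative_def by simp
qed


section \<open>Bounded differentiable functions\<close>

lemma CWk_on_0: "CWk_on 0 S f \<longleftrightarrow> continuous_on S f \<and> bounded (f ` S)"
  by (simp add: CWk_on_def)

lemma CWk_on_Suc:
  "CWk_on (Suc k) S f \<longleftrightarrow>
     (\<forall>x\<in>S. f differentiable (at x within S)) \<and> bounded (f ` S) \<and>
     (\<forall>b\<in>Basis. CWk_on k S (dir_deriv S b f))"
  by (auto simp: CWk_on_def)

lemma CWk_on_imp_bounded: "CWk_on k S f \<Longrightarrow> bounded (f ` S)"
  by (cases k) (auto simp: CWk_on_def)

lemma CWk_on_cong:
  assumes "\<And>x. x \<in> S \<Longrightarrow> f x = g x"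
  shows "CWk_on k S f \<longleftrightarrow> CWk_on k S g"
  using assms
proof (induction k arbitrary: f g)
  case 0
  then have "f ` S = g ` S" by (intro image_cong) auto
  moreover have "continuous_on S f \<longleftrightarrow> continuous_on S g"
    using 0 by (intro continuous_on_cong) auto
  ultimately show ?case by (simp add: CWk_on_0)
next
  case (Suc k)
  have "f ` S = g ` S" using Suc.prems by (intro image_cong) auto
  moreover have "f differentiable (at x within S) \<longleftrightarrow> g differentiable (at x within S)" if "x \<in> S" for x
    using that Suc.prems has_derivative_transform[of x S f g] has_derivative_transform[of x S g f]
    unfolding differentiable_def by metis
  moreover have "CWk_on k S (dir_deriv S b f) \<longleftrightarrow> CWk_on k S (dir_deriv S b g)" for b
    using Suc.prems by (intro Suc.IH) (simp add: frechet_derivative_within_cong[of _ S f g])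
  ultimately show ?case by (simp add: CWk_on_Suc)
qed

text \<open>
  Differentiability and boundedness are checked together: the derivative of a product or of a
  composition has the expected form only where the factors are differentiable, so the bounds on
  higher derivatives cannot be obtained separately from \<open>C\<^sup>k\<close> regularity. Closure under sums,
  products and compositions comes from this rule, by exhibiting a derivative whose components belong
  to the class one order lower.
\<close>

lemma CWk_on_SucI:
  assumes S: "axis_accessible S"
    and D: "\<And>x. x \<in> S \<Longrightarrow> (f has_derivative D x) (at x within S)"
    and bdd: "bounded (f ` S)"
    and k: "\<And>b. b \<in> Basis \<Longrightarrow> CWk_on k S (\<lambda>x. D x b)"
  shows "CWk_on (Suc k) S f"
  unfolding CWk_on_Suc
proof (intro conjI ballI)
  show "f differentiable (at x within S)" if "x \<in> S" for x
    using D[OF that] by (rule differentiableI)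
  show "CWk_on k S (dir_deriv S b f)" if "b \<in> Basis" for b
    using k[OF that] CWk_on_cong[of S "dir_deriv S b f" "\<lambda>x. D x b" k]
    by (simp add: frechet_derivative_within_eq[OF S _ D])
qed (rule bdd)

lemma CWk_on_has_derivative:
  assumes "CWk_on (Suc k) S f" "x \<in> S"
  shows "(f has_derivative frechet_derivative f (at x within S)) (at x within S)"
  using assms frechet_derivative_works CWk_on_Suc by blast

lemma CWk_on_dir_deriv:
  assumes "CWk_on (Suc k) S f" "b \<in> Basis"
  shows "CWk_on k S (dir_deriv S b f)"
  using assms CWk_on_Suc by blast

lemma CWk_on_Suc_imp: "CWk_on (Suc k) S f \<Longrightarrow> CWk_on k S f"
proof (induction k arbitrary: f)
  case 0
  then show ?case
    by (auto simp: CWk_on_Suc CWk_on_0 continuous_on_eq_continuous_within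
        intro: differentiable_imp_continuous_within)
next
  case (Suc k)
  then show ?case using CWk_on_Suc by blast
qed

lemma CWk_on_mono: "CWk_on k S f \<Longrightarrow> j \<le> k \<Longrightarrow> CWk_on j S f"
  by (induction k) (auto simp: le_Suc_eq dest: CWk_on_Suc_imp)

lemma CWk_on_continuous: "CWk_on k S f \<Longrightarrow> continuous_on S f"
  using CWk_on_mono[of k S f 0] by (simp add: CWk_on_0)

lemma CWk_on_const:
  assumes "axis_accessible S"
  shows "CWk_on k S (\<lambda>x. c)"
proof (induction k arbitrary: c)
  case 0
  then show ?case by (simp add: CWk_on_0 image_constant_conv)
next
  case (Suc k)
  show ?case
    by (rule CWk_on_SucI[OF assms, where D = "\<lambda>x h. 0"]) (auto simp: Suc image_constant_conv)
qed

lemma CWk_on_add: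
  assumes S: "axis_accessible S" and "CWk_on k S f" "CWk_on k S g"
  shows "CWk_on k S (\<lambda>x. f x + g x)"
  using assms(2,3)
proof (induction k arbitrary: f g)
  case 0
  then show ?case by (auto simp: CWk_on_0 intro: continuous_on_add bounded_plus_comp)
next
  case (Suc k)
  show ?case
  proof (rule CWk_on_SucI[OF S])
    fix x assume "x \<in> S"
    then show "((\<lambda>x. f x + g x) has_derivative (\<lambda>h. frechet_derivative f (at x within S) h +
        frechet_derivative g (at x within S) h)) (at x within S)"
      using Suc.prems by (intro has_derivative_add CWk_on_has_derivative)
  next
    show "bounded ((\<lambda>x. f x + g x) ` S)"
      using Suc.prems by (intro bounded_plus_comp CWk_on_imp_bounded)
  qed (use Suc in \<open>auto intro: CWk_on_dir_deriv\<close>)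
qed

lemma CWk_on_sum:
  assumes S: "axis_accessible S" and "finite I" "\<And>i. i \<in> I \<Longrightarrow> CWk_on k S (f i)"
  shows "CWk_on k S (\<lambda>x. \<Sum>i\<in>I. f i x)"
  using assms(2,3)
  by (induction I rule: finite_induct) (auto intro: CWk_on_const[OF S] CWk_on_add[OF S])

lemma (in bounded_bilinear) bounded_prod_image:
  assumes "bounded (f ` S)" "bounded (g ` S)"
  shows "bounded ((\<lambda>x. prod (f x) (g x)) ` S)"
proof -
  obtain K where K: "\<And>a b. norm (prod a b) \<le> norm a * norm b * K" "0 \<le> K" using nonneg_bounded by blast
  obtain B C where B: "\<And>x. x \<in> S \<Longrightarrow> norm (f x) \<le> B" and C: "\<And>x. x \<in> S \<Longrightarrow> norm (g x) \<le> C"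
    using assms by (auto simp: bounded_iff)
  have "norm (prod (f x) (g x)) \<le> B * C * K" if "x \<in> S" for x
    using K(2) B[OF that] C[OF that]
    by (intro order_trans[OF K(1)] mult_right_mono mult_mono) (auto intro: order_trans[OF norm_ge_zero])
  then show ?thesis by (auto simp: bounded_iff)
qed

lemma (in bounded_bilinear) CWk_on_prod:
  assumes S: "axis_accessible S" and "CWk_on k S f" "CWk_on k S g"
  shows "CWk_on k S (\<lambda>x. prod (f x) (g x))"
  using assms(2,3)
proof (induction k arbitrary: f g)
  case 0
  then show ?case by (auto simp: CWk_on_0 intro: continuous_on bounded_prod_image)
next
  case (Suc k)
  show ?case
  proof (rule CWk_on_SucI[OF S])
    fix x assume "x \<in> S"
    then show "((\<lambda>x. prod (f x) (g x)) has_derivative (\<lambda>h.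
        prod (f x) (frechet_derivative g (at x within S) h) +
        prod (frechet_derivative f (at x within S) h) (g x))) (at x within S)"
      using Suc.prems by (intro FDERIV CWk_on_has_derivative)
  next
    show "bounded ((\<lambda>x. prod (f x) (g x)) ` S)"
      using Suc.prems by (intro bounded_prod_image CWk_on_imp_bounded)
  next
    fix b :: 'd assume "b \<in> Basis"
    then show "CWk_on k S (\<lambda>x. prod (f x) (dir_deriv S b g x) + prod (dir_deriv S b f x) (g x))"
      using Suc.prems by (auto intro!: CWk_on_add[OF S] Suc.IH CWk_on_dir_deriv dest: CWk_on_Suc_imp)
  qed
qed

lemmas CWk_on_scaleR = bounded_bilinear.CWk_on_prod[OF bounded_bilinear_scaleR]
lemmas CWk_on_mult = bounded_bilinear.CWk_on_prod[OF bounded_bilinear_mult]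

lemma CWk_on_linear:
  assumes L: "bounded_linear L" and S: "axis_accessible S" and f: "CWk_on k S f"
  shows "CWk_on k S (\<lambda>x. L (f x))"
  using f
proof (induction k arbitrary: f)
  case 0
  then show ?case
    using bounded_linear_image[of "f ` S" L] bounded_linear.continuous_on[OF L, of S f] L
    by (simp add: CWk_on_0 image_image)
next
  case (Suc k)
  show ?case
  proof (rule CWk_on_SucI[OF S])
    fix x assume "x \<in> S"
    then show "((\<lambda>x. L (f x)) has_derivative (\<lambda>h. L (frechet_derivative f (at x within S) h)))
        (at x within S)"
      using bounded_linear.has_derivative[OF L CWk_on_has_derivative[OF Suc.prems]] by simp
  next
    show "bounded ((\<lambda>x. L (f x)) ` S)"
      using bounded_linear_image[OF CWk_on_imp_bounded[OF Suc.prems] L] by (simp add: image_image)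
  qed (use Suc in \<open>auto intro: CWk_on_dir_deriv\<close>)
qed

text \<open>
  The regularity of inner functions. The map \<open>(t, x) \<mapsto> x - x\<^sub>L(t)\<close> is unbounded, yet composing a bounded
  function with it gives a bounded function; what the chain rule needs to be bounded are the
  derivatives of order at least one.
\<close>

primrec bounded_grad_on ::
  "nat \<Rightarrow> 'a::euclidean_space set \<Rightarrow> ('a \<Rightarrow> 'b::real_normed_vector) \<Rightarrow> bool" where
  "bounded_grad_on 0 S g \<longleftrightarrow> continuous_on S g"
| "bounded_grad_on (Suc k) S g \<longleftrightarrow>
     (\<forall>x\<in>S. g differentiable (at x within S)) \<and>
     (\<forall>b\<in>Basis. CWk_on k S (dir_deriv S b g))"

lemma CWk_on_imp_bounded_grad_on: "CWk_on k S g \<Longrightarrow> bounded_grad_on k S g"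
  by (cases k) (auto simp: CWk_on_0 CWk_on_Suc)

lemma bounded_grad_on_imp_CWk_on: "bounded_grad_on k S g \<Longrightarrow> bounded (g ` S) \<Longrightarrow> CWk_on k S g"
  by (cases k) (auto simp: CWk_on_0 CWk_on_Suc)

lemma bounded_grad_on_Suc_imp: "bounded_grad_on (Suc k) S g \<Longrightarrow> bounded_grad_on k S g"
  by (cases k) (auto simp: continuous_on_eq_continuous_within
        intro: differentiable_imp_continuous_within CWk_on_Suc_imp)

lemma bounded_grad_on_linear:
  assumes L: "bounded_linear L" and S: "axis_accessible S"
  shows "bounded_grad_on k S L"
proof (cases k)
  case 0
  then show ?thesis using L by (simp add: linear_continuous_on)
next
  case (Suc j)
  have D: "(L has_derivative L) (at x within S)" for x
    using L by (rule bounded_linear_imp_has_derivative)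
  have "CWk_on j S (dir_deriv S b L)" for b
    using CWk_on_const[OF S, of j "L b"] CWk_on_cong[of S "dir_deriv S b L" "\<lambda>x. L b" j]
    by (simp add: frechet_derivative_within_eq[OF S _ D])
  then show ?thesis using Suc D by (auto intro: differentiableI)
qed

lemma bounded_grad_on_diff:
  assumes S: "axis_accessible S" and f: "bounded_grad_on k S f" and g: "bounded_grad_on k S g"
  shows "bounded_grad_on k S (\<lambda>x. f x - g x)"
proof (cases k)
  case 0
  then show ?thesis using f g by (auto intro: continuous_on_diff)
next
  case (Suc j)
  have D: "((\<lambda>x. f x - g x) has_derivative (\<lambda>h. frechet_derivative f (at x within S) h -
      frechet_derivative g (at x within S) h)) (at x within S)" if "x \<in> S" for x
    using that f g Suc by (intro has_derivative_diff) (auto simp: frechet_derivative_works)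
  have "CWk_on j S (dir_deriv S b (\<lambda>x. f x - g x))" if b: "b \<in> Basis" for b
  proof -
    have "CWk_on j S (\<lambda>x. dir_deriv S b f x + - dir_deriv S b g x)"
      using f g Suc b
      by (intro CWk_on_add[OF S] CWk_on_linear[OF bounded_linear_minus[OF bounded_linear_ident] S]) auto
    then show ?thesis
      using CWk_on_cong[of S "dir_deriv S b (\<lambda>x. f x - g x)" "\<lambda>x. dir_deriv S b f x + - dir_deriv S b g x" j]
      by (simp add: frechet_derivative_within_eq[OF S _ D])
  qed
  then show ?thesis using Suc D by (auto intro: differentiableI)
qed

lemma linear_eq_sum_Basis:
  fixes F :: "'a::euclidean_space \<Rightarrow> 'b::real_vector"
  assumes "linear F"
  shows "F h = (\<Sum>b\<in>Basis. (h \<bullet> b) *\<^sub>R F b)"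
  using linear_sum[OF assms, of "\<lambda>b. (h \<bullet> b) *\<^sub>R b" Basis]
  by (simp add: euclidean_representation linear_scale[OF assms])

text \<open>
  By the chain rule a directional derivative of the composition is a finite sum of products of a
  derivative of \<open>g\<close> and a derivative of \<open>f\<close> composed with \<open>g\<close>; the latter are covered by the
  induction hypothesis, and \<open>g\<close> itself does not occur as a factor.
\<close>

lemma CWk_on_compose:
  fixes f :: "'b::euclidean_space \<Rightarrow> 'c::real_normed_vector"
    and g :: "'a::euclidean_space \<Rightarrow> 'b"
  assumes S: "axis_accessible S"
    and "CWk_on k T f" "bounded_grad_on k S g" "g ` S \<subseteq> T"
  shows "CWk_on k S (\<lambda>x. f (g x))"
  using assms(2,3)
proof (induction k arbitrary: f)
  case 0
  have "(\<lambda>x. f (g x)) ` S \<subseteq> f ` T" using assms(4) by auto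
  with 0 show ?case
    using assms(4) by (auto simp: CWk_on_0 intro: continuous_on_compose2 bounded_subset)
next
  case (Suc k)
  have bdd: "bounded ((\<lambda>x. f (g x)) ` S)"
    using CWk_on_imp_bounded[OF Suc.prems(1)] assms(4) by (auto elim!: bounded_subset)
  have D: "((\<lambda>x. f (g x)) has_derivative (\<lambda>h. frechet_derivative f (at (g x) within T)
      (frechet_derivative g (at x within S) h))) (at x within S)" if "x \<in> S" for x
  proof (rule has_derivative_in_compose2[OF _ assms(4) that])
    show "(f has_derivative frechet_derivative f (at y within T)) (at y within T)" if "y \<in> T" for y
      using CWk_on_has_derivative[OF Suc.prems(1) that] .
    show "(g has_derivative frechet_derivative g (at x within S)) (at x within S)"
      using Suc.prems(2) that frechet_derivative_works by auto
  qed
  show ?case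
  proof (rule CWk_on_SucI[OF S D bdd])
    fix b :: 'a assume b: "b \<in> Basis"
    have "CWk_on k S (\<lambda>x. \<Sum>i\<in>Basis. (dir_deriv S b g x \<bullet> i) *\<^sub>R dir_deriv T i f (g x))"
    proof (intro CWk_on_sum[OF S] CWk_on_scaleR[OF S])
      fix i :: 'b assume i: "i \<in> Basis"
      show "CWk_on k S (\<lambda>x. dir_deriv S b g x \<bullet> i)"
        using Suc.prems(2) b by (intro CWk_on_linear[OF bounded_linear_inner_left S]) auto
      show "CWk_on k S (\<lambda>x. dir_deriv T i f (g x))"
        using Suc.IH[OF CWk_on_dir_deriv[OF Suc.prems(1) i] bounded_grad_on_Suc_imp[OF Suc.prems(2)]] .
    qed auto
    moreover have "frechet_derivative f (at (g x) within T) (dir_deriv S b g x)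
        = (\<Sum>i\<in>Basis. (dir_deriv S b g x \<bullet> i) *\<^sub>R dir_deriv T i f (g x))" if "x \<in> S" for x
    proof -
      have "g x \<in> T" using that assms(4) by auto
      then have "linear (frechet_derivative f (at (g x) within T))"
        using CWk_on_has_derivative[OF Suc.prems(1)] has_derivative_linear by blast
      then show ?thesis by (rule linear_eq_sum_Basis)
    qed
    ultimately show "CWk_on k S (\<lambda>x. frechet_derivative f (at (g x) within T) (dir_deriv S b g x))"
      using CWk_on_cong[of S "\<lambda>x. frechet_derivative f (at (g x) within T) (dir_deriv S b g x)"
        "\<lambda>x. \<Sum>i\<in>Basis. (dir_deriv S b g x \<bullet> i) *\<^sub>R dir_deriv T i f (g x)" k] by simp
  qed
qed


section \<open>Functions of compact support\<close>

lemma dir_deriv_eq_0_outside: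
  assumes "closed K" "\<And>y. y \<notin> K \<Longrightarrow> f y = 0" "x \<notin> K"
  shows "frechet_derivative f (at x) = (\<lambda>h. 0)"
proof -
  have "(f has_derivative (\<lambda>h. 0)) (at x)"
    by (rule has_derivative_transform_within_open[of "\<lambda>x. 0" _ _ _ "- K"]) (use assms in auto)
  then show ?thesis by (rule frechet_derivative_at[symmetric])
qed

text \<open>
  All derivatives vanish outside the same compact set, and on it they are bounded by continuity.
\<close>

lemma Ck_on_imp_CWk_on:
  assumes "Ck_on k UNIV f" "compact K" "\<And>x. x \<notin> K \<Longrightarrow> f x = 0"
  shows "CWk_on k UNIV f"
  using assms(1,3)
proof (induction k arbitrary: f)
  case 0
  have "range f \<subseteq> insert 0 (f ` K)" using 0 by force
  moreover have "bounded (f ` K)"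
    using 0 assms(2) by (auto intro!: compact_imp_bounded compact_continuous_image elim: continuous_on_subset)
  ultimately have "bounded (range f)" by (meson bounded_insert bounded_subset)
  with 0 show ?case by (simp add: CWk_on_0)
next
  case (Suc k)
  have d: "CWk_on k UNIV (dir_deriv UNIV b f)" if "b \<in> Basis" for b
    using Suc.prems that dir_deriv_eq_0_outside[OF compact_imp_closed[OF assms(2)] Suc.prems(2)]
    by (intro Suc.IH) auto
  have "continuous_on UNIV f"
    using Suc.prems(1) by (auto simp: continuous_on_eq_continuous_within
        intro: differentiable_imp_continuous_within)
  moreover have "range f \<subseteq> insert 0 (f ` K)" using Suc.prems by force
  moreover have "bounded (f ` K)"
    using \<open>continuous_on UNIV f\<close> assms(2)
    by (auto intro!: compact_imp_bounded compact_continuous_image elim: continuous_on_subset)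
  ultimately have "bounded (range f)" by (meson bounded_insert bounded_subset)
  with d Suc.prems show ?case by (simp add: CWk_on_Suc)
qed

lemma Ck_compact_supportD:
  assumes "Ck_compact_support k f"
  obtains K where "compact K" "\<And>x. x \<notin> K \<Longrightarrow> f x = 0" "CWk_on k UNIV f"
proof (rule that)
  show K: "compact (closure {x. f x \<noteq> 0})" using assms by (simp add: Ck_compact_support_def)
  show 0: "f x = 0" if "x \<notin> closure {x. f x \<noteq> 0}" for x using that closure_subset[of "{x. f x \<noteq> 0}"] by auto
  show "CWk_on k UNIV f"
    by (rule Ck_on_imp_CWk_on[OF _ K 0]) (use assms in \<open>simp add: Ck_compact_support_def\<close>)
qed


section \<open>The normal vector as a function of the slope\<close>

text \<open>
  A graph with gradient \<open>A\<close> has the unit normal \<open>(- A, 1) / sqrt (1 + \<parallel>A\<parallel>\<^sup>2)\<close>. The slope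
  \<open>A\<close> enters the model only through the vertical component and, up to the sign, the horizontal one.
\<close>

definition normal_height :: "'a::real_inner \<Rightarrow> real" where
  "normal_height A = 1 / sqrt (1 + (norm A)\<^sup>2)"

definition normal_slope :: "'a::real_inner \<Rightarrow> 'a" where
  "normal_slope A = normal_height A *\<^sub>R A"

lemma normal_height_has_derivative:
  "(normal_height has_derivative (\<lambda>h. - (normal_height A * normal_height A) * (normal_slope A \<bullet> h))) (at A)"
proof -
  let ?s = "sqrt (1 + A \<bullet> A)"
  have pos: "1 + A \<bullet> A > 0" by (simp add: add_pos_nonneg)
  have "((\<lambda>A. inverse (sqrt (1 + A \<bullet> A))) has_derivative
      (\<lambda>h. - (inverse ?s * ((A \<bullet> h + h \<bullet> A) * (inverse ?s / 2)) * inverse ?s))) (at A)"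
    using pos by (auto intro!: derivative_eq_intros)
  moreover have "normal_height = (\<lambda>A :: 'a. inverse (sqrt (1 + A \<bullet> A)))"
    by (auto simp: normal_height_def power2_norm_eq_inner inverse_eq_divide)
  moreover have "- (inverse ?s * ((A \<bullet> h + h \<bullet> A) * (inverse ?s / 2)) * inverse ?s)
      = - (normal_height A * normal_height A) * (normal_slope A \<bullet> h)" for h
    by (simp add: normal_height_def normal_slope_def power2_norm_eq_inner inverse_eq_divide inner_commute)
  ultimately show ?thesis by simp
qed

lemma normal_slope_has_derivative:
  "(normal_slope has_derivative
     (\<lambda>h. normal_height A *\<^sub>R h - (normal_height A * (normal_slope A \<bullet> h)) *\<^sub>R normal_slope A)) (at A)"
proof -
  have "((\<lambda>A. normal_height A *\<^sub>R A) has_derivative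
      (\<lambda>h. normal_height A *\<^sub>R h + (- (normal_height A * normal_height A) * (normal_slope A \<bullet> h)) *\<^sub>R A)) (at A)"
    by (intro has_derivative_scaleR normal_height_has_derivative has_derivative_ident)
  moreover have "normal_slope = (\<lambda>A :: 'a. normal_height A *\<^sub>R A)" by (auto simp: normal_slope_def)
  moreover have "normal_height A *\<^sub>R h + (- (normal_height A * normal_height A) * (normal_slope A \<bullet> h)) *\<^sub>R A
      = normal_height A *\<^sub>R h - (normal_height A * (normal_slope A \<bullet> h)) *\<^sub>R normal_slope A" for h
    by (simp add: normal_slope_def)
  ultimately show ?thesis by simp
qed

lemma normal_height_bounds: "0 \<le> normal_height A" "normal_height A \<le> 1"
proof -
  have "1 \<le> sqrt (1 + (norm A)\<^sup>2)" by simp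
  then show "0 \<le> normal_height A" "normal_height A \<le> 1"
    unfolding normal_height_def by (simp, intro divide_le_eq_1_pos[THEN iffD2]) linarith+
qed

lemma norm_normal_slope_le: "norm (normal_slope A) \<le> 1"
proof -
  have "norm A \<le> sqrt (1 + (norm A)\<^sup>2)" by (rule real_le_rsqrt) simp
  moreover have "0 < sqrt (1 + (norm A)\<^sup>2)" by (simp add: add_pos_nonneg)
  ultimately show ?thesis by (simp add: normal_slope_def normal_height_def)
qed

text \<open>
  The first derivatives of the two components are polynomials in the components themselves. As both
  components are bounded by one, so are, by a simultaneous induction, all derivatives of any order,
  uniformly in \<open>A\<close>.
\<close>

lemma CWk_on_normal_components:
  "CWk_on k UNIV (normal_height :: 'a::euclidean_space \<Rightarrow> real) \<and>
   CWk_on k UNIV (normal_slope :: 'a \<Rightarrow> 'a)"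
proof -
  have bp: "bounded (range (normal_height :: 'a \<Rightarrow> real))"
    using normal_height_bounds[where 'a = 'a] by (auto simp: bounded_iff intro!: exI[of _ 1])
  have bP: "bounded (range (normal_slope :: 'a \<Rightarrow> 'a))"
    using norm_normal_slope_le by (auto simp: bounded_iff intro!: exI[of _ 1])
  show ?thesis
  proof (induction k)
    case 0
    show ?case
      using bp bP normal_height_has_derivative normal_slope_has_derivative
      by (auto simp: CWk_on_0 continuous_on_eq_continuous_within intro: has_derivative_continuous)
  next
    case (Suc k)
    let ?p = "normal_height :: 'a \<Rightarrow> real" and ?P = "normal_slope :: 'a \<Rightarrow> 'a"
    have p: "CWk_on k UNIV ?p" and P: "CWk_on k UNIV ?P" using Suc by auto
    have Pb: "CWk_on k UNIV (\<lambda>A. ?P A \<bullet> b)" for b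
      by (intro CWk_on_linear[OF bounded_linear_inner_left] P) simp
    have pp: "CWk_on k UNIV (\<lambda>A. - (?p A * ?p A))"
      by (intro CWk_on_linear[OF bounded_linear_minus[OF bounded_linear_ident]] CWk_on_mult p) simp_all
    have pPb: "CWk_on k UNIV (\<lambda>A. - (?p A * (?P A \<bullet> b)))" for b
      by (intro CWk_on_linear[OF bounded_linear_minus[OF bounded_linear_ident]] CWk_on_mult p Pb) simp_all
    have "CWk_on (Suc k) UNIV ?p"
      by (rule CWk_on_SucI[OF _ normal_height_has_derivative bp]) (intro CWk_on_mult pp Pb axis_accessible_UNIV)+
    moreover have "CWk_on (Suc k) UNIV ?P"
    proof (rule CWk_on_SucI[OF _ normal_slope_has_derivative bP])
      fix b :: 'a
      have "CWk_on k UNIV (\<lambda>A. ?p A *\<^sub>R b + (- (?p A * (?P A \<bullet> b))) *\<^sub>R ?P A)"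
        by (intro CWk_on_add CWk_on_scaleR CWk_on_const p P pPb) simp_all
      then show "CWk_on k UNIV (\<lambda>A. ?p A *\<^sub>R b - (?p A * (?P A \<bullet> b)) *\<^sub>R ?P A)" by simp
    qed simp
    ultimately show ?case by blast
  qed
qed


section \<open>Radial functions\<close>

text \<open>
  Away from the origin this is the chain rule. At the origin the norm is not differentiable, and
  \<open>W'(0) = 0\<close> is what repairs this. The gradient is \<open>q(\<parallel>x\<parallel>) x\<close> with \<open>q(s) = W'(s) / s\<close>, and \<open>q\<close> extends
  continuously by \<open>q(0) = W''(0)\<close>. The Hessian is
  \<open>q(\<parallel>x\<parallel>) Id + (W''(\<parallel>x\<parallel>) - q(\<parallel>x\<parallel>)) x x\<^sup>T / \<parallel>x\<parallel>\<^sup>2\<close>, in which the factor of the bounded but discontinuous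
  matrix \<open>x x\<^sup>T / \<parallel>x\<parallel>\<^sup>2\<close> tends to zero at the origin.
\<close>

lemma Ck_compact_support_radial:
  fixes W :: "real \<Rightarrow> real"
  assumes W: "Ck_compact_support 2 W" and W0: "deriv W 0 = 0"
  obtains \<rho> where "CWk_on 2 UNIV (\<lambda>x::'a::euclidean_space. W (norm x))"
    "\<And>x::'a. norm x > \<rho> \<Longrightarrow> W (norm x) = 0"
proof -
  obtain K where "compact K" and K: "\<And>s. s \<notin> K \<Longrightarrow> W s = 0" and CW: "CWk_on 2 UNIV W"
    using Ck_compact_supportD[OF W] by blast
  obtain \<rho> where \<rho>: "\<And>s. s \<in> K \<Longrightarrow> norm s \<le> \<rho>"
    using compact_imp_bounded[OF \<open>compact K\<close>] by (auto simp: bounded_iff)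
  have supp: "W (norm x) = 0" if "norm x > \<rho>" for x :: 'a
    using K \<rho>[of "norm x"] that by fastforce
  define V where "V = (\<lambda>s. frechet_derivative W (at s) 1)"
  define V1 where "V1 = (\<lambda>s. frechet_derivative V (at s) 1)"
  have CV: "CWk_on 1 UNIV V"
    using CWk_on_dir_deriv[of 1 UNIV W 1] CW by (simp add: V_def numeral_2_eq_2)
  have CV1: "continuous_on UNIV V1"
    using CWk_on_dir_deriv[of 0 UNIV V 1] CV by (simp add: V1_def CWk_on_0)
  have real_deriv: "(f has_real_derivative frechet_derivative f (at s) 1) (at s)"
    if "(f has_derivative frechet_derivative f (at s)) (at s)" for f :: "real \<Rightarrow> real" and s
  proof -
    have "linear (frechet_derivative f (at s))" using that has_derivative_linear by blast
    then have "frechet_derivative f (at s) h = frechet_derivative f (at s) 1 * h" for h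
      using linear_scale[of "frechet_derivative f (at s)" h 1] by (simp add: mult.commute)
    then have "frechet_derivative f (at s) = (*) (frechet_derivative f (at s) 1)" by (rule ext)
    with that show ?thesis unfolding has_field_derivative_def by metis
  qed
  have dW: "(W has_real_derivative V s) (at s)" for s
    unfolding V_def using CWk_on_has_derivative[of 1 UNIV W s] CW
    by (intro real_deriv) (simp add: numeral_2_eq_2)
  have dV: "(V has_real_derivative V1 s) (at s)" for s
    unfolding V1_def using CWk_on_has_derivative[of 0 UNIV V s] CV by (intro real_deriv) simp
  have V0: "V 0 = 0" using dW[of 0] W0 DERIV_imp_deriv by force
  define q where "q s = (if s = 0 then V1 0 else V s / s)" for s
  have q0: "isCont q 0"
  proof -
    have "(\<lambda>s. V s / s) \<midarrow>0\<rightarrow> V1 0" using dV[of 0] V0 by (simp add: DERIV_def)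
    then have "q \<midarrow>0\<rightarrow> V1 0" by (rule Lim_transform_eventually) (auto simp: q_def eventually_at_filter)
    then show ?thesis by (simp add: isCont_def q_def)
  qed
  have dq: "(q has_real_derivative (V1 s - q s) / s) (at s)" if "s \<noteq> 0" for s
  proof -
    have "((\<lambda>s. V s / s) has_real_derivative (V1 s - q s) / s) (at s)"
      using that by (auto intro!: derivative_eq_intros dV simp: q_def field_simps)
    then show ?thesis
      by (rule has_field_derivative_transform_within_open[of _ _ _ "- {0}"]) (use that in \<open>auto simp: q_def\<close>)
  qed
  have cq: "continuous_on UNIV q"
    unfolding continuous_on_eq_continuous_at[OF open_UNIV] using q0 dq DERIV_isCont by metis
  have dG: "((\<lambda>x. W (norm x)) has_derivative (\<lambda>h. q (norm x) * (x \<bullet> h))) (at x)" for x :: 'a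
  proof (cases "x = 0")
    case True
    have "(*) (V 0) = (\<lambda>h. 0)" using V0 by auto
    then have "(W has_derivative (\<lambda>h. 0)) (at 0)"
      using dW[of 0] unfolding has_field_derivative_def by simp
    then have "\<forall>e>0. \<exists>d>0. \<forall>s. norm s < d \<longrightarrow> norm (W s - W 0) \<le> e * norm s"
      by (simp add: has_derivative_at_alt)
    then have "\<forall>e>0. \<exists>d>0. \<forall>y::'a. norm y < d \<longrightarrow> norm (W (norm y) - W 0) \<le> e * norm y"
      by (metis real_norm_def abs_norm_cancel)
    then show ?thesis using True by (simp add: has_derivative_at_alt)
  next
    case False
    have "((\<lambda>x. W (norm x)) has_derivative (\<lambda>h. V (norm x) * (sgn x \<bullet> h))) (at x)"
      using has_derivative_compose[OF has_derivative_norm[OF False]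
          dW[of "norm x", unfolded has_field_derivative_def]] by (simp add: inner_commute)
    moreover have "V (norm x) * (sgn x \<bullet> h) = q (norm x) * (x \<bullet> h)" for h
      using False by (simp add: q_def sgn_div_norm divide_inverse)
    ultimately show ?thesis by simp
  qed
  have dG1: "((\<lambda>x. q (norm x) * (x \<bullet> h)) has_derivative
      (\<lambda>k. q (norm x) * (k \<bullet> h) + (V1 (norm x) - q (norm x)) * (sgn x \<bullet> k) * (sgn x \<bullet> h))) (at x)"
    for x h :: 'a
  proof (cases "x = 0")
    case True
    \<comment> \<open>The value of \<open>sgn 0\<close> is \<open>0\<close>, so at the origin the claimed derivative is \<open>q 0 * (k \<bullet> h)\<close>; for it, continuity of \<open>q\<close> suffices.\<close>
    have "\<exists>d>0. \<forall>y::'a. norm y < d \<longrightarrow> norm (q (norm y) * (y \<bullet> h) - q 0 * (y \<bullet> h)) \<le> e * norm y"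
      if e: "e > 0" for e :: real
    proof -
      have "e / (norm h + 1) > 0" using e by (simp add: add_nonneg_pos)
      then obtain d where d: "d > 0" "\<And>s. \<bar>s\<bar> < d \<Longrightarrow> \<bar>q s - q 0\<bar> < e / (norm h + 1)"
        using q0 by (auto simp: continuous_at_eps_delta dist_real_def)
      have "norm (q (norm y) * (y \<bullet> h) - q 0 * (y \<bullet> h)) \<le> e * norm y" if "norm y < d" for y :: 'a
      proof -
        have "norm (q (norm y) * (y \<bullet> h) - q 0 * (y \<bullet> h)) = \<bar>q (norm y) - q 0\<bar> * \<bar>y \<bullet> h\<bar>"
          by (simp add: left_diff_distrib[symmetric] abs_mult)
        also have "\<dots> \<le> e / (norm h + 1) * (norm y * norm h)"
          using d(2)[of "norm y"] that e by (intro mult_mono Cauchy_Schwarz_ineq2) auto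
        also have "\<dots> = (e * norm y) * (norm h / (norm h + 1))" by simp
        also have "\<dots> \<le> (e * norm y) * 1"
          using e by (intro mult_left_mono) (auto simp: divide_le_eq add_nonneg_pos)
        finally show ?thesis by simp
      qed
      with d(1) show ?thesis by blast
    qed
    then show ?thesis using True
      by (auto simp: has_derivative_at_alt
          intro!: bounded_linear_compose[OF bounded_linear_mult_right bounded_linear_inner_left])
  next
    case False
    have dqn: "((\<lambda>x. q (norm x)) has_derivative
        (\<lambda>k. (V1 (norm x) - q (norm x)) / norm x * (sgn x \<bullet> k))) (at x)"
      using has_derivative_compose[OF has_derivative_norm[OF False]
          dq[of "norm x", unfolded has_field_derivative_def]] False by (simp add: inner_commute)
    have "((\<lambda>x. q (norm x) * (x \<bullet> h)) has_derivative (\<lambda>k. q (norm x) * (k \<bullet> h) +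
        (V1 (norm x) - q (norm x)) / norm x * (sgn x \<bullet> k) * (x \<bullet> h))) (at x)"
      by (intro has_derivative_mult dqn has_derivative_inner_left has_derivative_ident)
    moreover have "(V1 (norm x) - q (norm x)) / norm x * (sgn x \<bullet> k) * (x \<bullet> h) =
        (V1 (norm x) - q (norm x)) * (sgn x \<bullet> k) * (sgn x \<bullet> h)" for k
      by (simp add: sgn_div_norm divide_inverse)
    ultimately show ?thesis by simp
  qed
  have cG2: "continuous_on UNIV (\<lambda>x::'a. q (norm x) * (k \<bullet> h) +
      (V1 (norm x) - q (norm x)) * (sgn x \<bullet> k) * (sgn x \<bullet> h))" for k h
  proof (rule continuous_on_add)
    have cD: "continuous_on UNIV (\<lambda>x::'a. V1 (norm x) - q (norm x))"
      by (intro continuous_on_diff continuous_on_compose2[OF CV1] continuous_on_compose2[OF cq]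
          continuous_on_norm continuous_on_id) auto
    show "continuous_on UNIV (\<lambda>x::'a. q (norm x) * (k \<bullet> h))"
      by (intro continuous_on_mult continuous_on_const continuous_on_compose2[OF cq]
          continuous_on_norm continuous_on_id) auto
    \<comment> \<open>The function \<open>sgn\<close> jumps at the origin but stays bounded, and \<open>V1 0 - q 0 = 0\<close>.\<close>
    show "continuous_on UNIV (\<lambda>x::'a. (V1 (norm x) - q (norm x)) * (sgn x \<bullet> k) * (sgn x \<bullet> h))"
      unfolding continuous_on_eq_continuous_at[OF open_UNIV]
    proof
      fix x :: 'a
      have iD: "isCont (\<lambda>x::'a. V1 (norm x) - q (norm x)) y" for y
        using cD by (simp add: continuous_on_eq_continuous_at)
      show "isCont (\<lambda>x::'a. (V1 (norm x) - q (norm x)) * (sgn x \<bullet> k) * (sgn x \<bullet> h)) x"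
      proof (cases "x = 0")
        case True
        have "((\<lambda>x::'a. (V1 (norm x) - q (norm x)) * (sgn x \<bullet> k) * (sgn x \<bullet> h)) \<longlongrightarrow> 0) (at 0)"
        proof (rule Lim_null_comparison)
          have "norm ((V1 (norm y) - q (norm y)) * (sgn y \<bullet> k) * (sgn y \<bullet> h))
              \<le> \<bar>V1 (norm y) - q (norm y)\<bar> * norm k * norm h" for y :: 'a
          proof -
            have "\<bar>sgn y \<bullet> c\<bar> \<le> norm c" for c :: 'a
              using Cauchy_Schwarz_ineq2[of "sgn y" c] by (cases "y = 0") (auto simp: norm_sgn)
            then show ?thesis unfolding real_norm_def abs_mult by (intro mult_mono) auto
          qed
          then show "\<forall>\<^sub>F y in at 0. norm ((V1 (norm y) - q (norm y)) * (sgn y \<bullet> k) * (sgn y \<bullet> h))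
              \<le> \<bar>V1 (norm y) - q (norm y)\<bar> * norm k * norm (h::'a)" by simp
          have "(\<lambda>y::'a. V1 (norm y) - q (norm y)) \<midarrow>0\<rightarrow> 0" using iD[of 0] by (simp add: isCont_def q_def)
          then show "((\<lambda>y::'a. \<bar>V1 (norm y) - q (norm y)\<bar> * norm k * norm h) \<longlongrightarrow> 0) (at 0)"
            by (intro tendsto_mult_left_zero tendsto_rabs_zero)
        qed
        then show ?thesis using True by (simp add: isCont_def)
      next
        case False
        then show ?thesis by (intro continuous_mult iD continuous_inner continuous_const isCont_sgn) auto
      qed
    qed
  qed
  have "Ck_on 2 UNIV (\<lambda>x::'a. W (norm x))"
    using dG dG1 cG2
    by (auto simp: numeral_2_eq_2 frechet_derivative_at[OF dG, symmetric]
        frechet_derivative_at[OF dG1, symmetric] intro: differentiableI)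
  then have "CWk_on 2 UNIV (\<lambda>x::'a. W (norm x))"
    by (rule Ck_on_imp_CWk_on[of _ _ "cball 0 \<rho>"]) (auto simp: supp)
  with supp show ?thesis using that by blast
qed


section \<open>The gradient of a convolution\<close>

lemma norm_linear_le_sum_Basis:
  fixes F :: "'a::euclidean_space \<Rightarrow> 'b::real_normed_vector"
  assumes "linear F"
  shows "norm (F h) \<le> (\<Sum>b\<in>Basis. norm (F b)) * norm h"
proof -
  have "F h = (\<Sum>b\<in>Basis. (h \<bullet> b) *\<^sub>R F b)"
    by (rule linear_eq_sum_Basis[OF assms])
  also have "norm \<dots> \<le> (\<Sum>b\<in>Basis. norm (F b) * norm h)"
  proof (rule sum_norm_le)
    fix b :: 'a assume "b \<in> Basis"
    from mult_right_mono[OF Basis_le_norm[OF this], of "norm (F b)"]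
    show "norm ((h \<bullet> b) *\<^sub>R F b) \<le> norm (F b) * norm h" by (simp add: mult.commute)
  qed
  finally show ?thesis by (simp add: sum_distrib_right)
qed

lemma CWk_on_imp_Lipschitz:
  fixes f :: "'a::euclidean_space \<Rightarrow> 'b::real_normed_vector"
  assumes f: "CWk_on 1 UNIV f"
  obtains L where "L \<ge> 0" "\<And>x y. norm (f x - f y) \<le> L * norm (x - y)"
proof -
  have "\<forall>b\<in>Basis. \<exists>M. \<forall>x. norm (dir_deriv UNIV b f x) \<le> M"
    using CWk_on_imp_bounded[OF CWk_on_dir_deriv[of 0 UNIV f]] f by (auto simp: bounded_iff)
  then obtain M where M: "\<And>b x. b \<in> Basis \<Longrightarrow> norm (dir_deriv UNIV b f x) \<le> M b" by metis
  have D: "(f has_derivative frechet_derivative f (at x)) (at x)" for x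
    using CWk_on_has_derivative[of 0 UNIV f x] f by simp
  have "onorm (frechet_derivative f (at x)) \<le> (\<Sum>b\<in>Basis. M b)" for x
  proof (rule onorm_le)
    fix h
    have "norm (frechet_derivative f (at x) h) \<le> (\<Sum>b\<in>Basis. norm (dir_deriv UNIV b f x)) * norm h"
      by (rule norm_linear_le_sum_Basis[OF has_derivative_linear[OF D]])
    also have "\<dots> \<le> (\<Sum>b\<in>Basis. M b) * norm h"
      by (intro mult_right_mono sum_mono M) auto
    finally show "norm (frechet_derivative f (at x) h) \<le> (\<Sum>b\<in>Basis. M b) * norm h" .
  qed
  then have "norm (f x - f y) \<le> (\<Sum>b\<in>Basis. M b) * norm (x - y)" for x y
    by (intro differentiable_bound[OF convex_UNIV D]) auto
  moreover have "0 \<le> (\<Sum>b\<in>Basis. M b)"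
    using M by (intro sum_nonneg) (auto intro: order_trans[OF norm_ge_zero])
  ultimately show ?thesis using that by blast
qed

text \<open>
  Bounded second derivatives make the first derivative Lipschitz continuous, with a constant that
  serves all base points. This uniformity is what allows the remainder to be integrated against a
  function that is merely locally integrable.
\<close>

lemma CWk_on_imp_quadratic_remainder:
  fixes f :: "'a::euclidean_space \<Rightarrow> 'b::real_normed_vector"
  assumes f: "CWk_on 2 UNIV f"
  obtains C where "C \<ge> 0"
    "\<And>z h. norm (f (z + h) - f z - frechet_derivative f (at z) h) \<le> C * (norm h)\<^sup>2"
proof -
  have "\<forall>b\<in>Basis. \<exists>L\<ge>0. \<forall>x y. norm (dir_deriv UNIV b f x - dir_deriv UNIV b f y) \<le> L * norm (x - y)"
  proof
    fix b :: 'a assume "b \<in> Basis"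
    then have "CWk_on 1 UNIV (dir_deriv UNIV b f)"
      using CWk_on_dir_deriv[of 1 UNIV f] f by (simp add: numeral_2_eq_2)
    from CWk_on_imp_Lipschitz[OF this]
    show "\<exists>L\<ge>0. \<forall>x y. norm (dir_deriv UNIV b f x - dir_deriv UNIV b f y) \<le> L * norm (x - y)"
      by metis
  qed
  then obtain L where L: "\<And>b. b \<in> Basis \<Longrightarrow> L b \<ge> 0"
    "\<And>b x y. b \<in> Basis \<Longrightarrow> norm (dir_deriv UNIV b f x - dir_deriv UNIV b f y) \<le> L b * norm (x - y)"
    by metis
  define C where "C = (\<Sum>b\<in>Basis. L b)"
  have C: "C \<ge> 0" unfolding C_def using L(1) by (rule sum_nonneg)
  have D: "(f has_derivative frechet_derivative f (at x)) (at x)" for x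
    using CWk_on_has_derivative[of 1 UNIV f x] f by (simp add: numeral_2_eq_2)
  have "norm (f (z + h) - f z - frechet_derivative f (at z) h) \<le> C * (norm h)\<^sup>2" for z h
  proof -
    have "onorm (frechet_derivative f (at x) - frechet_derivative f (at z)) \<le> C * norm h"
      if "x \<in> cball z (norm h)" for x
    proof (rule onorm_le)
      fix k
      let ?F = "\<lambda>k. frechet_derivative f (at x) k - frechet_derivative f (at z) k"
      have "linear ?F" using D has_derivative_linear linear_compose_sub by blast
      then have "norm (?F k) \<le> (\<Sum>b\<in>Basis. norm (?F b)) * norm k" by (rule norm_linear_le_sum_Basis)
      also have "\<dots> \<le> (\<Sum>b\<in>Basis. L b * norm (x - z)) * norm k"
        by (intro mult_right_mono sum_mono L) auto
      also have "\<dots> = C * norm (x - z) * norm k" by (simp add: C_def sum_distrib_right)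
      also have "\<dots> \<le> C * norm h * norm k"
        using that C by (intro mult_right_mono mult_left_mono) (auto simp: dist_norm norm_minus_commute)
      finally show "norm ((frechet_derivative f (at x) - frechet_derivative f (at z)) k) \<le> C * norm h * norm k"
        by simp
    qed
    then have "norm (f (z + h) - f z - frechet_derivative f (at z) (z + h - z)) \<le> norm (z + h - z) * (C * norm h)"
      by (intro differentiable_bound_linearization[where S = "cball z (norm h)"] has_derivative_at_withinI[OF D])
         (auto simp: dist_norm mult_left_le_one_le)
    then show ?thesis by (simp add: power2_eq_square mult_ac)
  qed
  with C that show ?thesis by blast
qed

lemma locally_integrable_add:
  assumes "locally_integrable f" "locally_integrable g"
  shows "locally_integrable (\<lambda>x. f x + g x)"
  using assms unfolding locally_integrable_def by (auto intro: set_integral_add)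

lemma integrable_conv:
  fixes f H :: "real^'N \<Rightarrow> real"
  assumes f: "continuous_on UNIV f" and supp: "\<And>z. norm z > \<rho> \<Longrightarrow> f z = 0"
    and H: "locally_integrable H"
  shows "integrable lebesgue (\<lambda>\<xi>. f (x - \<xi>) * H \<xi>)"
proof -
  let ?K = "cball x \<rho>"
  have c: "continuous_on S (\<lambda>\<xi>. f (x - \<xi>))" for S
    by (intro continuous_on_compose2[OF f] continuous_intros) auto
  have "(\<lambda>\<xi>. f (x - \<xi>) * H \<xi>) absolutely_integrable_on ?K"
  proof (rule absolutely_integrable_bounded_measurable_product[OF bilinear_times])
    show "(\<lambda>\<xi>. f (x - \<xi>)) \<in> borel_measurable (lebesgue_on ?K)"
      by (intro continuous_imp_measurable_on_sets_lebesgue c) auto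
    show "bounded ((\<lambda>\<xi>. f (x - \<xi>)) ` ?K)"
      by (intro compact_imp_bounded compact_continuous_image c) auto
    show "H absolutely_integrable_on ?K" using H by (auto simp: locally_integrable_def)
  qed auto
  moreover have "indicator ?K \<xi> *\<^sub>R (f (x - \<xi>) * H \<xi>) = f (x - \<xi>) * H \<xi>" for \<xi>
    using supp[of "x - \<xi>"] by (auto simp: indicator_def dist_norm)
  ultimately show ?thesis unfolding set_integrable_def by (simp only:)
qed

text \<open>
  For \<open>\<parallel>y - x\<parallel> \<le> 1\<close> the first order remainder of \<open>\<eta>(y - \<xi>)\<close> vanishes for \<open>\<xi>\<close> outside a fixed ball around \<open>x\<close>,
  and inside it is bounded by \<open>C \<parallel>y - x\<parallel>\<^sup>2\<close>. Integration against \<open>H\<close> therefore gives an error of at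
  most \<open>C M \<parallel>y - x\<parallel>\<^sup>2\<close>, with \<open>M\<close> the integral of \<open>\<bar>H\<bar>\<close> over the ball.
\<close>

lemma conv_has_derivative:
  fixes \<eta> H :: "real^'N \<Rightarrow> real"
  assumes \<eta>: "CWk_on 2 UNIV \<eta>" and supp: "\<And>z. norm z > \<rho> \<Longrightarrow> \<eta> z = 0"
    and H: "locally_integrable H"
  shows "(conv \<eta> H has_derivative (\<lambda>h. \<Sum>b\<in>Basis. (h \<bullet> b) * conv (dir_deriv UNIV b \<eta>) H x)) (at x)"
proof -
  let ?D = "\<lambda>h. \<Sum>b\<in>Basis. (h \<bullet> b) * conv (dir_deriv UNIV b \<eta>) H x"
  obtain C where C: "C \<ge> 0"
    "\<And>z h. norm (\<eta> (z + h) - \<eta> z - frechet_derivative \<eta> (at z) h) \<le> C * (norm h)\<^sup>2"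
    using CWk_on_imp_quadratic_remainder[OF \<eta>] by blast
  let ?K = "cball x (\<rho> + 1)"
  define m where "m \<xi> = indicator ?K \<xi> * \<bar>H \<xi>\<bar>" for \<xi>
  define M where "M = (LINT \<xi>|lebesgue. m \<xi>)"
  have m: "integrable lebesgue m"
  proof -
    have "(\<lambda>\<xi>. norm (H \<xi>)) absolutely_integrable_on ?K"
      using H by (intro absolutely_integrable_norm[unfolded o_def]) (auto simp: locally_integrable_def)
    then show ?thesis by (simp add: set_integrable_def m_def[abs_def])
  qed
  have M: "M \<ge> 0" unfolding M_def by (rule integral_nonneg_AE) (simp add: m_def)
  have deriv0: "frechet_derivative \<eta> (at z) = (\<lambda>h. 0)" if "norm z > \<rho>" for z
    using that supp by (intro dir_deriv_eq_0_outside[of "cball 0 \<rho>"]) auto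
  have int: "integrable lebesgue (\<lambda>\<xi>. \<eta> (y - \<xi>) * H \<xi>)" for y
    using \<eta> supp H by (intro integrable_conv[of _ \<rho>] CWk_on_continuous)
  have intD: "integrable lebesgue (\<lambda>\<xi>. dir_deriv UNIV b \<eta> (x - \<xi>) * H \<xi>)" if "b \<in> Basis" for b
  proof (rule integrable_conv[OF _ _ H])
    show "continuous_on UNIV (dir_deriv UNIV b \<eta>)"
      using \<eta> that by (intro CWk_on_continuous[of 1] CWk_on_dir_deriv) (simp add: numeral_2_eq_2)
    show "dir_deriv UNIV b \<eta> z = 0" if "norm z > \<rho>" for z using deriv0[OF that] by simp
  qed
  have remainder: "norm (conv \<eta> H y - conv \<eta> H x - ?D (y - x)) \<le> C * M * (norm (y - x))\<^sup>2"
    if y: "norm (y - x) \<le> 1" for y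
  proof -
    define r where "r \<xi> = \<eta> (y - \<xi>) - \<eta> (x - \<xi>) -
      (\<Sum>b\<in>Basis. ((y - x) \<bullet> b) * dir_deriv UNIV b \<eta> (x - \<xi>))" for \<xi>
    have rH: "r \<xi> * H \<xi> = \<eta> (y - \<xi>) * H \<xi> - \<eta> (x - \<xi>) * H \<xi> -
      (\<Sum>b\<in>Basis. ((y - x) \<bullet> b) * (dir_deriv UNIV b \<eta> (x - \<xi>) * H \<xi>))" for \<xi>
      by (simp add: r_def left_diff_distrib sum_distrib_right mult.assoc)
    have irH: "integrable lebesgue (\<lambda>\<xi>. r \<xi> * H \<xi>)"
      unfolding rH by (intro Bochner_Integration.integrable_diff int Bochner_Integration.integrable_sum
          integrable_mult_right intD)
    have "conv \<eta> H y - conv \<eta> H x - ?D (y - x) = (LINT \<xi>|lebesgue. r \<xi> * H \<xi>)"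
      unfolding rH conv_def
      by (simp add: int intD Bochner_Integration.integral_sum)
    also have "norm \<dots> \<le> (LINT \<xi>|lebesgue. C * (norm (y - x))\<^sup>2 * m \<xi>)"
    proof (rule Bochner_Integration.integral_norm_bound_integral[OF irH])
      show "integrable lebesgue (\<lambda>\<xi>. C * (norm (y - x))\<^sup>2 * m \<xi>)" using m by simp
      fix \<xi>
      show "norm (r \<xi> * H \<xi>) \<le> C * (norm (y - x))\<^sup>2 * m \<xi>"
      proof (cases "\<xi> \<in> ?K")
        case True
        have lin: "linear (frechet_derivative \<eta> (at (x - \<xi>)))"
          using CWk_on_has_derivative[of 1 UNIV \<eta>] \<eta> has_derivative_linear by (simp add: numeral_2_eq_2) blast
        have "frechet_derivative \<eta> (at (x - \<xi>)) (y - x)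
            = (\<Sum>b\<in>Basis. ((y - x) \<bullet> b) * dir_deriv UNIV b \<eta> (x - \<xi>))"
          using linear_eq_sum_Basis[OF lin, of "y - x"] by simp
        then have "\<bar>r \<xi>\<bar> \<le> C * (norm (y - x))\<^sup>2"
          using C(2)[of "x - \<xi>" "y - x"] by (simp add: r_def)
        then show ?thesis using True by (simp add: m_def abs_mult mult_right_mono)
      next
        case False
        then have "norm (x - \<xi>) > \<rho> + 1" by (simp add: dist_norm)
        moreover have "norm (x - \<xi>) \<le> norm (y - \<xi>) + norm (y - x)"
          using norm_triangle_ineq4[of "y - \<xi>" "y - x"] by simp
        ultimately have "norm (x - \<xi>) > \<rho>" "norm (y - \<xi>) > \<rho>" using y by linarith+
        then have "r \<xi> = 0" by (simp add: r_def supp deriv0)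
        then show ?thesis using C(1) by (simp add: m_def)
      qed
    qed
    also have "\<dots> = C * M * (norm (y - x))\<^sup>2" by (simp add: M_def)
    finally show ?thesis .
  qed
  show ?thesis
    unfolding has_derivative_at_alt
  proof (intro conjI allI impI)
    show "bounded_linear ?D"
      by (intro bounded_linear_sum bounded_linear_mult_left[THEN bounded_linear_compose]
          bounded_linear_inner_left)
    fix e :: real assume e: "e > 0"
    have CM: "C * M + 1 > 0" using C(1) M by (simp add: add_nonneg_pos)
    \<comment> \<open>The summand \<open>1\<close> in the denominator below only avoids a division by zero.\<close>
    show "\<exists>d>0. \<forall>y. norm (y - x) < d \<longrightarrow>
        norm (conv \<eta> H y - conv \<eta> H x - ?D (y - x)) \<le> e * norm (y - x)"
    proof (intro exI[of _ "min 1 (e / (C * M + 1))"] conjI allI impI)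
      show "min 1 (e / (C * M + 1)) > 0" using e CM by simp
      fix y assume y: "norm (y - x) < min 1 (e / (C * M + 1))"
      then have "norm (y - x) * (C * M + 1) \<le> e" using CM by (simp add: field_simps)
      then have "C * M * norm (y - x) \<le> e" by (simp add: algebra_simps) (smt (verit) norm_ge_zero)
      then have "C * M * norm (y - x) * norm (y - x) \<le> e * norm (y - x)"
        by (rule mult_right_mono) simp
      with remainder[of y] y
      show "norm (conv \<eta> H y - conv \<eta> H x - ?D (y - x)) \<le> e * norm (y - x)"
        by (simp add: power2_eq_square mult_ac)
    qed
  qed
qed

lemma grad_conv:
  fixes \<eta> H :: "real^'N \<Rightarrow> real"
  assumes "CWk_on 2 UNIV \<eta>" "\<And>z. norm z > \<rho> \<Longrightarrow> \<eta> z = 0" "locally_integrable H"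
  shows "grad (conv \<eta> H) x = (\<chi> k. conv (\<lambda>z. grad \<eta> z $ k) H x)"
proof -
  have "frechet_derivative (conv \<eta> H) (at x) (axis k 1) = conv (dir_deriv UNIV (axis k 1) \<eta>) H x" for k
  proof -
    have "frechet_derivative (conv \<eta> H) (at x) (axis k 1) =
        (\<Sum>b\<in>Basis. (axis k 1 \<bullet> b) * conv (dir_deriv UNIV b \<eta>) H x)"
      by (simp only: frechet_derivative_at[OF conv_has_derivative[OF assms], symmetric])
    also have "\<dots> = (\<Sum>b\<in>Basis. if b = axis k 1 then conv (dir_deriv UNIV b \<eta>) H x else 0)"
    proof (rule sum.cong[OF refl])
      fix b :: "real^'N" assume "b \<in> Basis"
      then show "(axis k 1 \<bullet> b) * conv (dir_deriv UNIV b \<eta>) H x =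
          (if b = axis k 1 then conv (dir_deriv UNIV b \<eta>) H x else 0)"
        using inner_Basis[of "axis k 1" b] by (cases "b = axis k 1") (simp_all add: axis_in_Basis_iff)
    qed
    finally show ?thesis by (simp add: axis_in_Basis_iff)
  qed
  then show ?thesis by (simp add: grad_on_def)
qed

lemma laser_kernel_mult_vector:
  "laser_kernel \<eta> z *v vector [a, b] =
     (grad \<eta> z $ 1 * (b + a)) *\<^sub>R axis 1 1 + (grad \<eta> z $ 2 * (b + a)) *\<^sub>R axis 2 1"
  by (simp add: laser_kernel_def vec_eq_iff forall_2 matrix_vector_mult_def sum_2 axis_def algebra_simps)

text \<open>
  Both columns of the kernel equal the gradient of \<open>\<eta>\<close>, so the nonlocal argument \<open>\<theta> * u\<close> is the gradient
  of \<open>\<eta>\<close> convolved with the sum of the two components.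
\<close>

lemma mconv_laser_kernel:
  assumes \<eta>: "CWk_on 2 UNIV \<eta>" and supp: "\<And>z. norm z > \<rho> \<Longrightarrow> \<eta> z = 0"
    and hm: "locally_integrable hm" and hs: "locally_integrable hs"
  shows "mconv (laser_kernel \<eta>) (\<lambda>x. vector [hm x, hs x]) x = grad (conv \<eta> (\<lambda>\<xi>. hs \<xi> + hm \<xi>)) x"
proof -
  let ?H = "\<lambda>\<xi>. hs \<xi> + hm \<xi>"
  have H: "locally_integrable ?H" using hs hm by (rule locally_integrable_add)
  have int: "integrable lebesgue (\<lambda>\<xi>. grad \<eta> (x - \<xi>) $ k * ?H \<xi>)" for k
  proof (rule integrable_conv[OF _ _ H])
    have "CWk_on 1 UNIV (dir_deriv UNIV (axis k 1) \<eta>)"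
      using \<eta> by (intro CWk_on_dir_deriv) (auto simp: numeral_2_eq_2)
    then show "continuous_on UNIV (\<lambda>z. grad \<eta> z $ k)"
      by (auto simp: grad_on_def dest: CWk_on_continuous)
    show "grad \<eta> z $ k = 0" if "norm z > \<rho>" for z
      using that supp dir_deriv_eq_0_outside[of "cball 0 \<rho>" \<eta> z] by (simp add: grad_on_def)
  qed
  have "mconv (laser_kernel \<eta>) (\<lambda>x. vector [hm x, hs x]) x =
      conv (\<lambda>z. grad \<eta> z $ 1) ?H x *\<^sub>R axis 1 1 + conv (\<lambda>z. grad \<eta> z $ 2) ?H x *\<^sub>R axis 2 1"
    unfolding mconv_def laser_kernel_mult_vector conv_def using int by simp
  then show ?thesis
    by (simp add: grad_conv[OF \<eta> supp H] vec_eq_iff forall_2 axis_def)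
qed

lemma kernel_assumption_laser_kernel:
  assumes "Ck_compact_support 3 \<eta>"
  shows "kernel_assumption (laser_kernel \<eta>)"
proof -
  obtain K where K: "compact K" "\<And>x. x \<notin> K \<Longrightarrow> \<eta> x = 0" "CWk_on 3 UNIV \<eta>"
    using Ck_compact_supportD[OF assms] by blast
  have d: "CWk_on 2 UNIV (\<lambda>x. grad \<eta> x $ k)" for k
    using CWk_on_dir_deriv[of 2 UNIV \<eta> "axis k 1"] K(3) by (simp add: grad_on_def numeral_3_eq_3 numeral_2_eq_2)
  have "laser_kernel \<eta> = (\<lambda>x. grad \<eta> x $ 1 *\<^sub>R vector [vector [1, 1], 0] + grad \<eta> x $ 2 *\<^sub>R vector [0, vector [1, 1]])"
    by (simp add: fun_eq_iff laser_kernel_def vec_eq_iff forall_2)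
  then have "CWk_on 2 UNIV (laser_kernel \<eta>)"
    using CWk_on_add[OF axis_accessible_UNIV CWk_on_scaleR[OF axis_accessible_UNIV d CWk_on_const]
      CWk_on_scaleR[OF axis_accessible_UNIV d CWk_on_const]] by simp
  moreover have "{x. laser_kernel \<eta> x \<noteq> 0} \<subseteq> K"
  proof
    fix x assume x: "x \<in> {x. laser_kernel \<eta> x \<noteq> 0}"
    show "x \<in> K"
    proof (rule ccontr)
      assume "x \<notin> K"
      then have "grad \<eta> x = 0"
        using dir_deriv_eq_0_outside[OF compact_imp_closed[OF K(1)] K(2)] by (simp add: grad_on_def vec_eq_iff)
      then have "laser_kernel \<eta> x = 0" by (simp add: laser_kernel_def vec_eq_iff forall_2)
      with x show False by simp
    qed
  qed
  then have "compact (closure {x. laser_kernel \<eta> x \<noteq> 0})"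
    using K(1) by (meson closure_minimal compact_closure compact_imp_bounded bounded_subset)
  ultimately show ?thesis by (simp add: kernel_assumption_def Ck_compact_support_def CWk_on_def)
qed


section \<open>Gradients and their norms\<close>

lemma bounded_linear_axis: "bounded_linear (axis k :: 'b \<Rightarrow> 'b::real_normed_vector^'k)"
proof (rule bounded_linear_intro[where K = 1])
  fix v :: 'b
  have "norm (axis k v :: 'b^'k) \<le> (\<Sum>j\<in>UNIV. norm (axis k v $ j :: 'b))"
    unfolding norm_vec_def by (rule L2_set_le_sum) simp
  also have "\<dots> = (\<Sum>j\<in>UNIV. if j = k then norm v else 0)"
    by (intro sum.cong) (auto simp: axis_def)
  finally show "norm (axis k v :: 'b^'k) \<le> norm v * 1" by simp
qed (auto simp: vec_eq_iff axis_def)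

lemma CWk_on_grad:
  fixes f :: "real^'k \<Rightarrow> 'b::real_normed_vector"
  assumes "CWk_on (Suc j) UNIV f"
  shows "CWk_on j UNIV (grad f)"
proof -
  have "grad f x = (\<Sum>k\<in>UNIV. axis k (dir_deriv UNIV (axis k 1) f x))" for x
    by (simp add: grad_on_def vec_eq_iff axis_def)
  then have "grad f = (\<lambda>x. \<Sum>k\<in>UNIV. axis k (dir_deriv UNIV (axis k 1) f x))" by (rule ext)
  moreover have "CWk_on j UNIV (\<lambda>x. \<Sum>k\<in>UNIV. axis k (dir_deriv UNIV (axis k 1) f x))"
    using assms by (intro CWk_on_sum CWk_on_linear[OF bounded_linear_axis] CWk_on_dir_deriv) auto
  ultimately show ?thesis by simp
qed

lemma grad_on_eq_grad:
  fixes f :: "real^'k \<Rightarrow> 'b::real_normed_vector"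
  assumes "CWk_on (Suc j) UNIV f" "axis_accessible S" "x \<in> S"
  shows "grad_on S f x = grad f x"
proof -
  have "(f has_derivative frechet_derivative f (at x)) (at x within S)"
    by (rule has_derivative_at_withinI[OF CWk_on_has_derivative[OF assms(1) UNIV_I]])
  from frechet_derivative_within_eq[OF assms(2,3) this] show ?thesis by (simp add: grad_on_def)
qed

lemma grad_on_cong:
  assumes "x \<in> S" "\<And>y. y \<in> S \<Longrightarrow> f y = g y"
  shows "grad_on S f x = grad_on S g x"
  using frechet_derivative_within_cong[of x S f g] assms by (simp add: grad_on_def)

lemma grad_on_linear:
  fixes f :: "real^'k \<Rightarrow> 'b::real_normed_vector"
  assumes L: "bounded_linear L" and S: "axis_accessible S" and x: "x \<in> S"
    and f: "f differentiable (at x within S)"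
  shows "grad_on S (\<lambda>y. L (f y)) x = (\<chi> k. L (grad_on S f x $ k))"
  using frechet_derivative_within_eq[OF S x bounded_linear.has_derivative[OF L f[unfolded frechet_derivative_works]]]
  by (simp add: grad_on_def)

lemma grad_on_add:
  fixes f :: "real^'k \<Rightarrow> 'b::real_normed_vector"
  assumes S: "axis_accessible S" and x: "x \<in> S"
    and f: "f differentiable (at x within S)" and g: "g differentiable (at x within S)"
  shows "grad_on S (\<lambda>y. f y + g y) x = grad_on S f x + grad_on S g x"
  using frechet_derivative_within_eq[OF S x has_derivative_add[OF f[unfolded frechet_derivative_works]
        g[unfolded frechet_derivative_works]]]
  by (simp add: grad_on_def vec_eq_iff)

lemma grad_shift:
  fixes f :: "real^'k \<Rightarrow> 'b::real_normed_vector"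
  assumes "f differentiable (at (x - a))"
  shows "grad (\<lambda>y. f (y - a)) x = grad f (x - a)"
proof -
  have "((\<lambda>y. y - a) has_derivative (\<lambda>h. h)) (at x)" by (auto intro!: derivative_eq_intros)
  from has_derivative_compose[OF this assms[unfolded frechet_derivative_works]]
  have "frechet_derivative (\<lambda>y. f (y - a)) (at x) = frechet_derivative f (at (x - a))"
    by (intro frechet_derivative_within_eq) auto
  then show ?thesis by (simp add: grad_on_def)
qed

lemma norm_vec_le_mult:
  fixes v :: "'a::real_normed_vector^'k" and u :: "'b::real_normed_vector^'k"
  assumes "c \<ge> 0" "\<And>k. norm (u $ k) \<le> c * norm (v $ k)"
  shows "norm u \<le> c * norm v"
proof -
  have "norm u \<le> L2_set (\<lambda>k. c * norm (v $ k)) UNIV"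
    unfolding norm_vec_def by (intro L2_set_mono) (auto simp: assms)
  also have "\<dots> = c * norm v"
    unfolding norm_vec_def by (rule L2_set_right_distrib[OF assms(1), symmetric])
  finally show ?thesis .
qed

text \<open>
  A bound for a linear map acting on the values carries over, with the same constant, to the
  Euclidean norm of the gradient, because the map acts on each component of the gradient.
\<close>

lemma norm_grad_on_linear_le:
  fixes f :: "real^'k \<Rightarrow> 'b::real_normed_vector"
  assumes "bounded_linear L" "c \<ge> 0" "\<And>v. norm (L v) \<le> c * norm v"
    and "axis_accessible S" "x \<in> S" "f differentiable (at x within S)"
  shows "norm (grad_on S (\<lambda>y. L (f y)) x) \<le> c * norm (grad_on S f x)"
  unfolding grad_on_linear[OF assms(1,4,5,6)] by (rule norm_vec_le_mult) (auto simp: assms)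

lemma norm_matrix_vector_mult_le:
  fixes M :: "real^'k^'j"
  shows "norm (M *v v) \<le> norm M * norm v"
proof -
  have "norm (M *v v) \<le> norm v * norm M"
  proof (rule norm_vec_le_mult)
    show "norm ((M *v v) $ j) \<le> norm v * norm (M $ j)" for j
      using Cauchy_Schwarz_ineq2[of "M $ j" v] by (simp add: matrix_vector_mul_component mult.commute)
  qed simp
  then show ?thesis by (simp add: mult.commute)
qed

lemma div_rows_scaleR:
  fixes g :: "real^'N \<Rightarrow> real" and M :: "real^'N^'n"
  assumes "g differentiable (at x)"
  shows "div_rows (\<lambda>y. g y *\<^sub>R M) x = M *v grad g x"
proof -
  have "((\<lambda>y. g y *\<^sub>R M $ j) has_derivative (\<lambda>h. frechet_derivative g (at x) h *\<^sub>R M $ j)) (at x)" for j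
    using assms[unfolded frechet_derivative_works] by (intro has_derivative_scaleR_left)
  then have "frechet_derivative (\<lambda>y. g y *\<^sub>R M $ j) (at x) = (\<lambda>h. frechet_derivative g (at x) h *\<^sub>R M $ j)" for j
    by (intro frechet_derivative_within_eq) auto
  then show ?thesis
    by (simp add: div_rows_def divergence_def vec_eq_iff matrix_vector_mult_def grad_on_def mult.commute)
qed

text \<open>
  A pointwise bound, rather than one on the supremum, so that it can also record decay in \<open>x\<close>.
\<close>

definition C2_bound :: "(real^'k \<Rightarrow> real) \<Rightarrow> real^'k \<Rightarrow> real \<Rightarrow> bool" where
  "C2_bound g x c \<longleftrightarrow> norm (g x) \<le> c \<and> norm (grad g x) \<le> c \<and> norm (grad (grad g) x) \<le> c"

lemma C2_bound_mono: "C2_bound g x c \<Longrightarrow> c \<le> d \<Longrightarrow> C2_bound g x d"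
  by (auto simp: C2_bound_def)

lemma CWk_on_2_imp_grad_bounds:
  fixes f :: "real^'k \<Rightarrow> 'b::real_normed_vector"
  assumes f: "CWk_on 2 UNIV f"
  obtains B where "B \<ge> 0"
    "\<And>x. norm (f x) \<le> B \<and> norm (grad f x) \<le> B \<and> norm (grad (grad f) x) \<le> B"
proof -
  have "CWk_on 1 UNIV (grad f)" "CWk_on 0 UNIV (grad (grad f))"
    using f by (auto intro!: CWk_on_grad simp: numeral_2_eq_2)
  then have "bounded (range f)" "bounded (range (grad f))" "bounded (range (grad (grad f)))"
    using f CWk_on_imp_bounded by blast+
  then obtain B0 B1 B2 where B: "\<And>x. norm (f x) \<le> B0" "\<And>x. norm (grad f x) \<le> B1"
      "\<And>x. norm (grad (grad f) x) \<le> B2"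
    by (auto simp: bounded_iff)
  have "max B0 (max B1 B2) \<ge> 0" using order_trans[OF norm_ge_zero B(1)] by auto
  then show ?thesis using that[of "max B0 (max B1 B2)"] B by (auto simp: le_max_iff_disj)
qed

lemma C2_bound_compact_support:
  fixes g :: "real^'k \<Rightarrow> real"
  assumes g: "CWk_on 2 UNIV g" and supp: "\<And>x. norm x > \<rho> \<Longrightarrow> g x = 0"
  obtains B where "B \<ge> 0" "\<And>x. C2_bound g x (B * indicator (cball 0 \<rho>) x)"
proof -
  obtain B where "B \<ge> 0"
    and B: "\<And>x. norm (g x) \<le> B \<and> norm (grad g x) \<le> B \<and> norm (grad (grad g) x) \<le> B"
    using CWk_on_2_imp_grad_bounds[OF g] by metis
  have "C2_bound g x (B * indicator (cball 0 \<rho>) x)" for x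
  proof (cases "norm x \<le> \<rho>")
    case True
    then show ?thesis using B[of x] by (simp add: C2_bound_def)
  next
    case False
    have g0: "grad g y = 0" if "norm y > \<rho>" for y
      using dir_deriv_eq_0_outside[of "cball 0 \<rho>" g y] that supp by (simp add: grad_on_def vec_eq_iff)
    have "grad (grad g) x = 0"
      using dir_deriv_eq_0_outside[of "cball 0 \<rho>" "grad g" x] False g0 by (simp add: grad_on_def[of UNIV "grad g"] vec_eq_iff)
    with g0 supp False show ?thesis by (simp add: C2_bound_def)
  qed
  with \<open>B \<ge> 0\<close> show ?thesis by (rule that)
qed

lemma CWk_on_differentiable: "CWk_on (Suc k) UNIV f \<Longrightarrow> f differentiable (at x)"
  by (simp add: CWk_on_Suc)

lemma C2_bound_shift:
  assumes g: "CWk_on 2 UNIV g" and b: "C2_bound g (x - a) c"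
  shows "C2_bound (\<lambda>y. g (y - a)) x c"
proof -
  have g': "CWk_on (Suc 1) UNIV g" and g'': "CWk_on (Suc 0) UNIV (grad g)"
    using g CWk_on_grad[of 1 g] by (auto simp: numeral_2_eq_2)
  have "grad (\<lambda>y. g (y - a)) = (\<lambda>y. grad g (y - a))"
    using grad_shift[OF CWk_on_differentiable[OF g']] by blast
  then show ?thesis
    using b grad_shift[OF CWk_on_differentiable[OF g'']] by (simp add: C2_bound_def)
qed

lemma C2_bound_lincomb:
  assumes f: "CWk_on 2 UNIV f" and g: "CWk_on 2 UNIV g"
    and bf: "C2_bound f x c" and bg: "C2_bound g x d"
  shows "C2_bound (\<lambda>y. a * f y + b * g y) x (\<bar>a\<bar> * c + \<bar>b\<bar> * d)"
proof -
  have f': "CWk_on (Suc 1) UNIV f" "CWk_on (Suc 0) UNIV (grad f)"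
    and g': "CWk_on (Suc 1) UNIV g" "CWk_on (Suc 0) UNIV (grad g)"
    using f g CWk_on_grad[of 1 f] CWk_on_grad[of 1 g] by (auto simp: numeral_2_eq_2)
  have lin: "grad (\<lambda>y. a *\<^sub>R p y + b *\<^sub>R q y) x = a *\<^sub>R grad p x + b *\<^sub>R grad q x"
    if p: "CWk_on (Suc j) UNIV p" and q: "CWk_on (Suc j) UNIV q"
    for p q :: "real^'a \<Rightarrow> 'c::real_normed_vector" and j x
  proof -
    have s: "bounded_linear (\<lambda>v::'c. c *\<^sub>R v)" for c by (rule bounded_linear_scaleR_right)
    have "grad (\<lambda>y. a *\<^sub>R p y + b *\<^sub>R q y) x = grad (\<lambda>y. a *\<^sub>R p y) x + grad (\<lambda>y. b *\<^sub>R q y) x"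
      using CWk_on_linear[OF s axis_accessible_UNIV p] CWk_on_linear[OF s axis_accessible_UNIV q]
      by (intro grad_on_add) (auto intro: CWk_on_differentiable)
    then show ?thesis
      using grad_on_linear[OF s axis_accessible_UNIV UNIV_I CWk_on_differentiable[OF p]]
        grad_on_linear[OF s axis_accessible_UNIV UNIV_I CWk_on_differentiable[OF q]]
      by (simp add: vec_eq_iff)
  qed
  have 1: "grad (\<lambda>y. a * f y + b * g y) = (\<lambda>y. a *\<^sub>R grad f y + b *\<^sub>R grad g y)"
    using lin[OF f'(1) g'(1)] by (simp add: fun_eq_iff)
  have tri: "norm (a *\<^sub>R v + b *\<^sub>R w) \<le> \<bar>a\<bar> * c + \<bar>b\<bar> * d"
    if "norm v \<le> c" "norm w \<le> d" for v w :: "'c::real_normed_vector"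
    using that by (intro norm_triangle_le add_mono) (auto intro: mult_left_mono)
  show ?thesis
    using bf bg tri[of "f x" "g x"]
    unfolding C2_bound_def 1 lin[OF f'(2) g'(2)] by (auto intro!: tri)
qed

lemma CWk_on_shift:
  fixes f :: "'a::euclidean_space \<Rightarrow> 'b::real_normed_vector"
  assumes "CWk_on k UNIV f"
  shows "CWk_on k UNIV (\<lambda>y. f (y - a))"
proof (rule CWk_on_compose[OF axis_accessible_UNIV assms])
  show "bounded_grad_on k UNIV (\<lambda>y. y - a)"
    by (rule bounded_grad_on_diff[OF axis_accessible_UNIV
          bounded_grad_on_linear[OF bounded_linear_ident axis_accessible_UNIV]
          CWk_on_imp_bounded_grad_on[OF CWk_on_const[OF axis_accessible_UNIV]]])
qed simp


section \<open>Fluxes with separated variables\<close>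

lemma param_box_eq_cbox: "param_box U = cbox (\<chi> k. - U) (\<chi> k. U)"
  by (auto simp: param_box_def mem_box_cart)

lemma axis_accessible_param_box: "U > 0 \<Longrightarrow> axis_accessible (param_box U :: (real^'m) set)"
  unfolding param_box_eq_cbox
  by (rule axis_accessible_cbox) (auto simp: Basis_vec_def inner_axis)

lemma axis_accessible_coeff_domain:
  "T > 0 \<Longrightarrow> U > 0 \<Longrightarrow> axis_accessible (coeff_domain T U :: (real \<times> (real^'N) \<times> real \<times> (real^'m)) set)"
  unfolding coeff_domain_def
  using axis_accessible_cbox[of 0 T] axis_accessible_cbox[of "-U" U]
  by (intro axis_accessible_Times axis_accessible_param_box) auto

text \<open>
  For fixed \<open>t\<close> and \<open>u\<close> the flux of the model is a scalar function of \<open>x\<close> times a matrix depending on \<open>A\<close>.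
  Then each of the six tensors in the assumption on the flux is the product, or a contraction, of
  one derivative of \<open>g\<close> and one of \<open>M\<close>, each of order at most two, and the bounds multiply.
\<close>

lemma separated_flux_bounds:
  fixes g :: "real^'N \<Rightarrow> real" and M :: "real^'m \<Rightarrow> real^'N^'n"
  assumes g: "CWk_on 2 UNIV g" and gc: "C2_bound g x c"
    and M: "CWk_on 2 UNIV M" and S: "axis_accessible S" and A: "A \<in> S"
    and MB: "norm (M A) \<le> B" "norm (grad M A) \<le> B" "norm (grad (grad M) A) \<le> B"
  shows "norm (grad (\<lambda>y. g y *\<^sub>R M A) x) \<le> c * B"
    and "norm (div_rows (\<lambda>y. g y *\<^sub>R M A) x) \<le> c * B"
    and "norm (grad (div_rows (\<lambda>y. g y *\<^sub>R M A)) x) \<le> c * B"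
    and "norm (grad (\<lambda>y. grad_on S (\<lambda>A. g y *\<^sub>R M A) A) x) \<le> c * B"
    and "norm (grad_on S (\<lambda>A. g x *\<^sub>R M A) A) \<le> c * B"
    and "norm (grad_on S (grad_on S (\<lambda>A. g x *\<^sub>R M A)) A) \<le> c * B"
proof -
  have g1: "g differentiable (at y)" and g2: "grad g differentiable (at y)" for y
    using g CWk_on_grad[of 1 g] CWk_on_differentiable[of 1 g] CWk_on_differentiable[of 0 "grad g"]
    by (auto simp: numeral_2_eq_2)
  have M1: "M differentiable (at A within S)" and M2: "grad M differentiable (at A within S)" for A
    using M CWk_on_grad[of 1 M] CWk_on_differentiable[of 1 M] CWk_on_differentiable[of 0 "grad M"]
    by (auto simp: numeral_2_eq_2 intro: differentiable_at_withinI)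
  have gM: "grad_on S M A = grad M A" if "A \<in> S" for A
    using M that by (intro grad_on_eq_grad[of 1] S) (simp_all add: numeral_2_eq_2)
  have ggM: "grad_on S (grad M) A = grad (grad M) A"
    using CWk_on_grad[of 1 M] M by (intro grad_on_eq_grad[of 0] S A) (simp add: numeral_2_eq_2)
  have bounds: "norm (g x) \<le> c" "norm (grad g x) \<le> c" "norm (grad (grad g) x) \<le> c"
    using gc by (auto simp: C2_bound_def)
  have c: "c \<ge> 0" and B: "B \<ge> 0" using bounds(1) MB(1) norm_ge_zero order_trans by blast+
  have prod: "p * q \<le> c * B" if "p \<le> B" "q \<le> c" "q \<ge> 0" for p q
    using mult_mono[OF that(1,2) B that(3)] by (simp add: mult.commute)
  have scale: "norm (grad (\<lambda>y. g y *\<^sub>R N) x) \<le> c * B"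
    if "norm N \<le> B" for N :: "'c::real_normed_vector"
  proof -
    have "norm (grad (\<lambda>y. g y *\<^sub>R N) x) \<le> norm N * norm (grad g x)"
      by (rule norm_grad_on_linear_le[OF bounded_linear_scaleR_left]) (auto simp: g1)
    also have "\<dots> \<le> c * B" using that bounds(2) by (intro prod) auto
    finally show ?thesis .
  qed
  have gradA: "grad_on S (\<lambda>A. a *\<^sub>R M A) A = a *\<^sub>R grad M A" if "A \<in> S" for a A
    using grad_on_linear[OF bounded_linear_scaleR_right S that M1, of a] by (simp add: gM[OF that] vec_eq_iff)
  have gradA2: "grad_on S (\<lambda>A. a *\<^sub>R grad M A) A = a *\<^sub>R grad (grad M) A" for a
    using grad_on_linear[OF bounded_linear_scaleR_right S A M2, of a] by (simp add: ggM vec_eq_iff)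
  have gradA2': "grad_on S (grad_on S (\<lambda>A. a *\<^sub>R M A)) A = a *\<^sub>R grad (grad M) A" for a
    using grad_on_cong[OF A, of "grad_on S (\<lambda>A. a *\<^sub>R M A)" "\<lambda>A. a *\<^sub>R grad M A"] gradA gradA2
    by simp
  show "norm (grad (\<lambda>y. g y *\<^sub>R M A) x) \<le> c * B" by (rule scale[OF MB(1)])
  have div: "div_rows (\<lambda>y. g y *\<^sub>R M A) = (\<lambda>y. M A *v grad g y)"
    by (rule ext) (rule div_rows_scaleR[OF g1])
  show "norm (div_rows (\<lambda>y. g y *\<^sub>R M A) x) \<le> c * B"
    unfolding div using MB(1) bounds(2) by (intro order_trans[OF norm_matrix_vector_mult_le] prod) auto
  have "norm (grad (\<lambda>y. M A *v grad g y) x) \<le> norm (M A) * norm (grad (grad g) x)"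
    by (rule norm_grad_on_linear_le[OF matrix_vector_mul_bounded_linear])
       (auto simp: g2 norm_matrix_vector_mult_le)
  also have "\<dots> \<le> c * B" using MB(1) bounds(3) by (intro prod) auto
  finally show "norm (grad (div_rows (\<lambda>y. g y *\<^sub>R M A)) x) \<le> c * B" unfolding div .
  show "norm (grad (\<lambda>y. grad_on S (\<lambda>A. g y *\<^sub>R M A) A) x) \<le> c * B"
    unfolding gradA[OF A] by (rule scale[OF MB(2)])
  have "\<bar>g x\<bar> * norm (grad M A) \<le> c * B" "\<bar>g x\<bar> * norm (grad (grad M) A) \<le> c * B"
    using bounds(1) MB c by (auto intro!: mult_mono)
  then show "norm (grad_on S (\<lambda>A. g x *\<^sub>R M A) A) \<le> c * B"
    and "norm (grad_on S (grad_on S (\<lambda>A. g x *\<^sub>R M A)) A) \<le> c * B"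
    by (simp_all add: gradA[OF A] gradA2')
qed


section \<open>Integrable bounds for the laser cutting model\<close>

text \<open>
  A continuous majorant of the indicator function of the ball of radius \<open>\<rho>\<close>, supported in the ball of
  radius \<open>\<rho> + 1\<close>.
\<close>

definition cutoff :: "real \<Rightarrow> 'a::real_normed_vector \<Rightarrow> real" where
  "cutoff \<rho> x = max 0 (min 1 (\<rho> + 1 - norm x))"

lemma cutoff_nonneg: "0 \<le> cutoff \<rho> x"
  by (simp add: cutoff_def)

text \<open>
  A profile supported in a ball around the moving centre \<open>y\<close> vanishes outside a fixed larger ball, as
  long as the centre stays bounded.
\<close>

lemma indicator_le_cutoff: "indicator (cball 0 \<rho>) (x - y) \<le> cutoff (\<rho> + \<sigma>) x" if "norm y \<le> \<sigma>"
  using norm_triangle_sub[of x y] that by (auto simp: cutoff_def indicator_def)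

lemma admissible_bound_cutoff:
  fixes K \<rho> :: real
  assumes K: "K \<ge> 0"
  shows "admissible_bound T (\<lambda>t (x::real^'N) U. K * (1 + U + U\<^sup>2) * cutoff \<rho> x)"
  unfolding admissible_bound_def
proof (intro conjI ballI allI impI)
  show "continuous_on ({0..T} \<times> UNIV \<times> {0..}) (\<lambda>(t, x::real^'N, U). K * (1 + U + U\<^sup>2) * cutoff \<rho> x)"
    unfolding cutoff_def case_prod_unfold by (intro continuous_intros)
  show "0 \<le> K * (1 + U + U\<^sup>2) * cutoff \<rho> x" if "0 \<le> U" for U and x :: "real^'N"
    using that K by (intro mult_nonneg_nonneg cutoff_nonneg) auto
  fix U :: real
  let ?f = "\<lambda>(t::real, x::real^'N). K * (1 + U + U\<^sup>2) * cutoff \<rho> x"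
  obtain a where a: "cball (0::real^'N) (\<rho> + 1) \<subseteq> cbox (- a) a"
    using bounded_subset_cbox_symmetric[OF bounded_cball] by blast
  have "continuous_on (cbox (0, - a) (T, a)) ?f"
    unfolding cutoff_def case_prod_unfold by (intro continuous_intros)
  then have "?f absolutely_integrable_on cbox (0, - a) (T, a)" by (rule absolutely_integrable_continuous)
  then have int: "?f absolutely_integrable_on {0..T} \<times> cbox (- a) a" by (simp add: cbox_Pair_eq)
  have 1: "{p \<in> ({0..T} \<times> cbox (- a) a) - ({0..T} \<times> UNIV). ?f p \<noteq> 0} = {}" by auto
  have 2: "{p \<in> ({0..T} \<times> UNIV) - ({0..T} \<times> cbox (- a) a). ?f p \<noteq> 0} = {}"
    using a by (fastforce simp: cutoff_def subset_iff)
  show "?f absolutely_integrable_on {0..T} \<times> UNIV"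
    by (rule absolutely_integrable_spike_set[OF int]) (simp_all only: 1 2 negligible_empty)
qed

definition first_row :: "real^2 \<Rightarrow> real^2^2" where
  "first_row v = vector [v, 0]"

lemma bounded_linear_first_row: "bounded_linear first_row"
  by (rule linear_conv_bounded_linear[THEN iffD1], rule linearI)
     (auto simp: first_row_def vec_eq_iff forall_2)

text \<open>
  The variables are separated: \<open>A\<close> occurs only in the matrix, while \<open>u\<close> enters the scalar factor as a
  polynomial, which is where the quadratic growth of the bound in \<open>U\<close> comes from.
\<close>

lemma laser_flux_eq:
  "laser_flux w Tg t x u A = (- u * w t x + u\<^sup>2 * Tg t x) *\<^sub>R first_row (normal_slope A)"
  by (simp add: laser_flux_def first_row_def normal_slope_def normal_height_def vec_eq_iff forall_2
      algebra_simps power2_eq_square diff_divide_distrib)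

definition source_direction :: "real^2 \<Rightarrow> real^2" where
  "source_direction A = (normal_height A * normal_height A) *\<^sub>R vector [1, - 1]"

lemma laser_source_eq: "laser_source i t x u A = i t x *\<^sub>R source_direction A"
proof -
  have "normal_height A * normal_height A = 1 / (1 + (norm A)\<^sup>2)" by (simp add: normal_height_def)
  then show ?thesis by (simp add: laser_source_def source_direction_def vec_eq_iff forall_2)
qed

lemma norm_source_direction_le: "norm (source_direction A) \<le> 2"
proof -
  have "norm (vector [1, - 1] :: real^2) \<le> 2"
    using norm_le_l1_cart[of "vector [1, - 1] :: real^2"] by (simp add: sum_2)
  moreover have "normal_height A * normal_height A \<le> 1" "normal_height A * normal_height A \<ge> 0"
    using normal_height_bounds[of A] by (simp_all add: mult_le_one)
  ultimately have "(normal_height A * normal_height A) * norm (vector [1, - 1] :: real^2) \<le> 1 * 2"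
    by (intro mult_mono) auto
  then show ?thesis using normal_height_bounds[of A] by (simp add: source_direction_def abs_mult)
qed

lemma CWk_on_coeff_of_moving_profile:
  fixes G :: "real^2 \<Rightarrow> real"
  assumes T: "0 < T" and U: "0 < U" and xL: "CWk_on 2 {0..T} xL" and G: "CWk_on 2 UNIV G"
  shows "CWk_on 2 (coeff_domain T U :: (real \<times> (real^2) \<times> real \<times> (real^2)) set)
           (\<lambda>z. G (fst (snd z) - xL (fst z)))"
proof (rule CWk_on_compose[OF axis_accessible_coeff_domain[OF T U] G])
  note S = axis_accessible_coeff_domain[OF T U]
  let ?S = "coeff_domain T U :: (real \<times> (real^2) \<times> real \<times> (real^2)) set"
  have "CWk_on 2 ?S (\<lambda>z. xL (fst z))"
    by (rule CWk_on_compose[OF S xL bounded_grad_on_linear[OF bounded_linear_fst S]])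
       (auto simp: coeff_domain_def)
  then show "bounded_grad_on 2 ?S (\<lambda>z. fst (snd z) - xL (fst z))"
    by (intro bounded_grad_on_diff[OF S] CWk_on_imp_bounded_grad_on
        bounded_grad_on_linear[OF bounded_linear_fst_comp[OF bounded_linear_snd] S])
qed simp

lemma CWk_on_coeff_of_unknown:
  assumes T: "0 < T" and U: "0 < U"
  shows "CWk_on 2 (coeff_domain T U :: (real \<times> (real^2) \<times> real \<times> (real^2)) set) (\<lambda>z. fst (snd (snd z)))"
proof (rule bounded_grad_on_imp_CWk_on)
  show "bounded_grad_on 2 (coeff_domain T U) (\<lambda>z::real \<times> (real^2) \<times> real \<times> (real^2). fst (snd (snd z)))"
    by (intro bounded_grad_on_linear axis_accessible_coeff_domain T U
        bounded_linear_fst_comp bounded_linear_snd_comp bounded_linear_snd)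
  show "bounded ((\<lambda>z::real \<times> (real^2) \<times> real \<times> (real^2). fst (snd (snd z))) ` coeff_domain T U)"
    by (rule bounded_subset[of "{- U..U}"]) (auto simp: coeff_domain_def)
qed

lemma CWk_on_coeff_of_slope:
  fixes M :: "real^2 \<Rightarrow> 'b::real_normed_vector"
  assumes T: "0 < T" and U: "0 < U" and M: "CWk_on 2 UNIV M"
  shows "CWk_on 2 (coeff_domain T U :: (real \<times> (real^2) \<times> real \<times> (real^2)) set) (\<lambda>z. M (snd (snd (snd z))))"
  by (rule CWk_on_compose[OF axis_accessible_coeff_domain[OF T U] M
        bounded_grad_on_linear[OF bounded_linear_snd_comp[OF bounded_linear_snd_comp[OF bounded_linear_snd]]
          axis_accessible_coeff_domain[OF T U]]]) simp

text \<open>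
  Every sufficiently large constant is allowed, so that a single function can serve both the flux and
  the source.
\<close>

lemma flux_assumption_laser_flux:
  fixes Gw Gs :: "real^2 \<Rightarrow> real" and xL :: "real \<Rightarrow> real^2"
  assumes T: "0 < T" and xL: "CWk_on 2 {0..T} xL" and \<sigma>: "\<And>t. t \<in> {0..T} \<Longrightarrow> norm (xL t) \<le> \<sigma>"
    and w: "CWk_on 2 UNIV Gw" "\<And>z. norm z > \<rho> \<Longrightarrow> Gw z = 0"
    and s: "CWk_on 2 UNIV Gs" "\<And>z. norm z > \<rho> \<Longrightarrow> Gs z = 0"
  obtains K where "K \<ge> 0"
    "\<And>K'. K' \<ge> K \<Longrightarrow> flux_assumption T (\<lambda>t x U. K' * (1 + U + U\<^sup>2) * cutoff (\<rho> + \<sigma>) x)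
       (laser_flux (\<lambda>t x. Gw (x - xL t)) (\<lambda>t x. Gs (x - xL t)))"
proof -
  define M where "M = (\<lambda>A. first_row (normal_slope A))"
  have M: "CWk_on 2 UNIV M"
    unfolding M_def using CWk_on_normal_components by (intro CWk_on_linear[OF bounded_linear_first_row]) auto
  obtain B where B: "B \<ge> 0" and MB: "\<And>A. norm (M A) \<le> B \<and> norm (grad M A) \<le> B \<and> norm (grad (grad M) A) \<le> B"
    using CWk_on_2_imp_grad_bounds[OF M] by metis
  obtain Bw where Bw: "Bw \<ge> 0" "\<And>z. C2_bound Gw z (Bw * indicator (cball 0 \<rho>) z)"
    using C2_bound_compact_support[OF w] by blast
  obtain Bs where Bs: "Bs \<ge> 0" "\<And>z. C2_bound Gs z (Bs * indicator (cball 0 \<rho>) z)"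
    using C2_bound_compact_support[OF s] by blast
  let ?\<phi> = "laser_flux (\<lambda>t x. Gw (x - xL t)) (\<lambda>t x. Gs (x - xL t))"
  show ?thesis
  proof (rule that[of "(Bw + Bs) * B"])
    show "(Bw + Bs) * B \<ge> 0" using B Bw Bs by simp
    fix K' assume K': "K' \<ge> (Bw + Bs) * B"
    let ?lam = "\<lambda>t (x::real^2) U. K' * (1 + U + U\<^sup>2) * cutoff (\<rho> + \<sigma>) x"
    show "flux_assumption T ?lam ?\<phi>"
      unfolding flux_assumption_def
    proof (intro allI impI conjI)
      fix U :: real assume U: "U > 0"
      note S = axis_accessible_coeff_domain[OF T U, where 'N = 2 and 'm = 2]
      let ?S = "coeff_domain T U :: (real \<times> (real^2) \<times> real \<times> (real^2)) set"
      let ?u = "\<lambda>z::real \<times> (real^2) \<times> real \<times> (real^2). fst (snd (snd z))"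
      let ?x = "\<lambda>z::real \<times> (real^2) \<times> real \<times> (real^2). fst (snd z) - xL (fst z)"
      note cu = CWk_on_coeff_of_unknown[OF T U]
      have "CWk_on 2 ?S (\<lambda>z. (- ?u z * Gw (?x z) + (?u z * ?u z) * Gs (?x z)) *\<^sub>R M (snd (snd (snd z))))"
        by (intro CWk_on_scaleR[OF S] CWk_on_add[OF S] CWk_on_mult[OF S] cu
            CWk_on_linear[OF bounded_linear_minus[OF bounded_linear_ident] S]
            CWk_on_coeff_of_moving_profile[OF T U xL] CWk_on_coeff_of_slope[OF T U] w s M)
      moreover have "(\<lambda>(t, x, u, A). ?\<phi> t x u A) =
          (\<lambda>z. (- ?u z * Gw (?x z) + (?u z * ?u z) * Gs (?x z)) *\<^sub>R M (snd (snd (snd z))))"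
        by (auto simp: laser_flux_eq M_def power2_eq_square)
      ultimately show "CWk_on 2 ?S (\<lambda>(t, x, u, A). ?\<phi> t x u A)" by simp
      have main: "norm (grad (\<lambda>y. ?\<phi> t y u A) x) \<le> ?lam t x U \<and>
          norm (div_rows (\<lambda>y. ?\<phi> t y u A) x) \<le> ?lam t x U \<and>
          norm (grad (div_rows (\<lambda>y. ?\<phi> t y u A)) x) \<le> ?lam t x U \<and>
          norm (grad (\<lambda>y. grad_on (param_box U) (?\<phi> t y u) A) x) \<le> ?lam t x U \<and>
          norm (grad_on (param_box U) (?\<phi> t x u) A) \<le> ?lam t x U \<and>
          norm (grad_on (param_box U) (grad_on (param_box U) (?\<phi> t x u)) A) \<le> ?lam t x U"
        if t: "t \<in> {0..T}" and u: "u \<in> {-U..U}" and A: "A \<in> param_box U" for t x u and A :: "real^2"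
      proof -
        define g where "g = (\<lambda>y. - u * Gw (y - xL t) + u\<^sup>2 * Gs (y - xL t))"
        define c where "c = (1 + U + U\<^sup>2) * (Bw + Bs) * cutoff (\<rho> + \<sigma>) x"
        let ?ind = "indicator (cball 0 \<rho>) (x - xL t) :: real"
        have \<phi>: "?\<phi> t y u = (\<lambda>A. g y *\<^sub>R M A)" for y
          by (rule ext) (simp add: laser_flux_eq g_def M_def)
        have g: "CWk_on 2 UNIV g"
          unfolding g_def
          by (intro CWk_on_add CWk_on_linear[OF bounded_linear_mult_right] CWk_on_shift w s) simp_all
        have "C2_bound g x (\<bar>- u\<bar> * (Bw * ?ind) + \<bar>u\<^sup>2\<bar> * (Bs * ?ind))"
          unfolding g_def by (intro C2_bound_lincomb CWk_on_shift C2_bound_shift w s Bw Bs)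
        moreover have "\<bar>- u\<bar> * (Bw * ?ind) + \<bar>u\<^sup>2\<bar> * (Bs * ?ind) \<le> c"
        proof -
          have ind: "0 \<le> ?ind" "?ind \<le> cutoff (\<rho> + \<sigma>) x"
            using indicator_le_cutoff[OF \<sigma>[OF t]] by auto
          have "u\<^sup>2 \<le> U\<^sup>2" using u by (intro abs_le_square_iff[THEN iffD1]) auto
          moreover have "\<bar>- u\<bar> \<le> U" using u by auto
          ultimately have "\<bar>- u\<bar> \<le> 1 + U + U\<^sup>2" "\<bar>u\<^sup>2\<bar> \<le> 1 + U + U\<^sup>2"
            using U zero_le_power2[of U] unfolding abs_power2 by linarith+
          then have "\<bar>- u\<bar> * (Bw * ?ind) + \<bar>u\<^sup>2\<bar> * (Bs * ?ind) \<le>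
              (1 + U + U\<^sup>2) * (Bw * cutoff (\<rho> + \<sigma>) x) + (1 + U + U\<^sup>2) * (Bs * cutoff (\<rho> + \<sigma>) x)"
            using ind Bw(1) Bs(1) by (intro add_mono mult_mono) auto
          then show ?thesis by (simp add: c_def algebra_simps)
        qed
        ultimately have gc: "C2_bound g x c" by (rule C2_bound_mono)
        have "c * B \<le> ?lam t x U"
        proof -
          have "(1 + U + U\<^sup>2) * cutoff (\<rho> + \<sigma>) x \<ge> 0" using U by (intro mult_nonneg_nonneg cutoff_nonneg) auto
          from mult_right_mono[OF K' this] show ?thesis by (simp add: c_def mult_ac)
        qed
        then show ?thesis
          using separated_flux_bounds[OF g gc M axis_accessible_param_box[OF U] A, of B] MB[of A]
          unfolding \<phi> by (meson order_trans)
      qed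
      then show "\<forall>(t, x, u, A)\<in>?S.
          norm (grad (\<lambda>y. ?\<phi> t y u A) x) \<le> ?lam t x U \<and>
          norm (div_rows (\<lambda>y. ?\<phi> t y u A) x) \<le> ?lam t x U \<and>
          norm (grad (div_rows (\<lambda>y. ?\<phi> t y u A)) x) \<le> ?lam t x U \<and>
          norm (grad (\<lambda>y. grad_on (param_box U) (?\<phi> t y u) A) x) \<le> ?lam t x U \<and>
          norm (grad_on (param_box U) (?\<phi> t x u) A) \<le> ?lam t x U \<and>
          norm (grad_on (param_box U) (grad_on (param_box U) (?\<phi> t x u)) A) \<le> ?lam t x U"
        unfolding coeff_domain_def by blast
    qed
  qed
qed

lemma source_assumption_laser_source:
  fixes Gi :: "real^2 \<Rightarrow> real" and xL :: "real \<Rightarrow> real^2"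
  assumes T: "0 < T" and xL: "CWk_on 2 {0..T} xL" and \<sigma>: "\<And>t. t \<in> {0..T} \<Longrightarrow> norm (xL t) \<le> \<sigma>"
    and i: "CWk_on 2 UNIV Gi" "\<And>z. norm z > \<rho> \<Longrightarrow> Gi z = 0"
  obtains K where "K \<ge> 0"
    "\<And>K'. K' \<ge> K \<Longrightarrow> source_assumption T (\<lambda>t x U. K' * (1 + U + U\<^sup>2) * cutoff (\<rho> + \<sigma>) x)
       (laser_source (\<lambda>t x. Gi (x - xL t)))"
proof -
  have N: "CWk_on 2 UNIV source_direction"
    unfolding source_direction_def[abs_def] using CWk_on_normal_components
    by (intro CWk_on_scaleR CWk_on_mult CWk_on_const) auto
  obtain B where B: "B \<ge> 0" "\<And>z. C2_bound Gi z (B * indicator (cball 0 \<rho>) z)"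
    using C2_bound_compact_support[OF i] by blast
  let ?\<Phi> = "laser_source (\<lambda>t x. Gi (x - xL t))"
  show ?thesis
  proof (rule that[of "2 * B"])
    show "2 * B \<ge> 0" using B by simp
    fix K' assume K': "K' \<ge> 2 * B"
    let ?lam = "\<lambda>t (x::real^2) U. K' * (1 + U + U\<^sup>2) * cutoff (\<rho> + \<sigma>) x"
    show "source_assumption T ?lam ?\<Phi>"
      unfolding source_assumption_def
    proof (intro allI impI conjI)
      fix U :: real assume U: "U > 0"
      note S = axis_accessible_coeff_domain[OF T U, where 'N = 2 and 'm = 2]
      let ?S = "coeff_domain T U :: (real \<times> (real^2) \<times> real \<times> (real^2)) set"
      have "CWk_on 2 ?S (\<lambda>z. Gi (fst (snd z) - xL (fst z)) *\<^sub>R source_direction (snd (snd (snd z))))"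
        by (intro CWk_on_scaleR[OF S]
            CWk_on_coeff_of_moving_profile[OF T U xL] CWk_on_coeff_of_slope[OF T U] i N)
      moreover have "(\<lambda>(t, x, u, A). ?\<Phi> t x u A) =
          (\<lambda>z. Gi (fst (snd z) - xL (fst z)) *\<^sub>R source_direction (snd (snd (snd z))))"
        by (auto simp: laser_source_eq)
      ultimately show "CWk_on 1 ?S (\<lambda>(t, x, u, A). ?\<Phi> t x u A)"
        using CWk_on_mono[of 2 ?S _ 1] by simp
      have "norm (?\<Phi> t x u A) \<le> ?lam t x U \<and> norm (grad (\<lambda>y. ?\<Phi> t y u A) x) \<le> ?lam t x U"
        if t: "t \<in> {0..T}" for t x u and A :: "real^2"
      proof -
        let ?g = "\<lambda>y. Gi (y - xL t)"
        define c where "c = B * cutoff (\<rho> + \<sigma>) x"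
        have "C2_bound ?g x (B * indicator (cball 0 \<rho>) (x - xL t))"
          by (intro C2_bound_shift i B)
        moreover have "B * indicator (cball 0 \<rho>) (x - xL t) \<le> c"
          unfolding c_def using B(1) indicator_le_cutoff[OF \<sigma>[OF t]] by (intro mult_left_mono) auto
        ultimately have "C2_bound ?g x c" by (rule C2_bound_mono)
        then have g: "norm (?g x) \<le> c" "norm (grad ?g x) \<le> c" by (auto simp: C2_bound_def)
        have c: "c \<ge> 0" using B(1) by (simp add: c_def cutoff_nonneg)
        have "c * 2 \<le> ?lam t x U"
        proof -
          have "c * 2 = (2 * B) * 1 * cutoff (\<rho> + \<sigma>) x" by (simp add: c_def)
          also have "\<dots> \<le> ?lam t x U"
            using K' U B(1) by (intro mult_right_mono mult_mono cutoff_nonneg) auto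
          finally show ?thesis .
        qed
        moreover have "norm (?\<Phi> t x u A) \<le> c * 2"
          unfolding laser_source_eq norm_scaleR
          using g(1) norm_source_direction_le c by (intro mult_mono) auto
        moreover have "norm (grad (\<lambda>y. ?\<Phi> t y u A) x) \<le> c * 2"
        proof -
          have "?g differentiable (at x)"
            using CWk_on_shift[OF i(1)] by (intro CWk_on_differentiable[of 1]) (simp add: numeral_2_eq_2)
          then have "norm (grad (\<lambda>y. ?g y *\<^sub>R source_direction A) x) \<le> norm (source_direction A) * norm (grad ?g x)"
            by (intro norm_grad_on_linear_le[OF bounded_linear_scaleR_left]) auto
          also have "\<dots> \<le> 2 * c"
            using g(2) norm_source_direction_le by (intro mult_mono) auto
          finally show ?thesis by (simp add: laser_source_eq)
        qed
        ultimately show ?thesis by linarith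
      qed
      then show "\<forall>(t, x, u, A)\<in>?S.
          max (norm (?\<Phi> t x u A)) (norm (grad (\<lambda>y. ?\<Phi> t y u A) x)) \<le> ?lam t x U"
        unfolding coeff_domain_def by auto
    qed
  qed
qed


section \<open>The laser cutting system\<close>

text \<open>
  The plateau of the profile \<open>S\<close> takes the role of the conditions \<open>W'(0) = 0\<close> and \<open>I'(0) = 0\<close>. As only
  the right half-line is controlled, the two-sided derivative is compared with the one within
  \<open>[0, r]\<close>.
\<close>

lemma deriv_eq_0_if_const_right:
  fixes S :: "real \<Rightarrow> real"
  assumes "0 < r" "\<And>\<xi>. \<xi> \<in> {0..r} \<Longrightarrow> S \<xi> = 1" and S: "S differentiable (at 0)"
  shows "deriv S 0 = 0"
proof -
  obtain d where d: "(S has_real_derivative d) (at 0)" using S real_differentiable_def by blast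
  have acc: "axis_accessible {0..r}" using axis_accessible_cbox[of 0 r] assms(1) by simp
  have mem: "0 \<in> {0..r}" using assms(1) by simp
  have "(S has_derivative (*) d) (at 0 within {0..r})"
    using has_field_derivative_at_within[OF d] unfolding has_field_derivative_def .
  note D = frechet_derivative_within_eq[OF acc mem this]
  have "(S has_derivative (\<lambda>h. 0)) (at 0 within {0..r})"
    by (rule has_derivative_transform[OF mem, of _ "\<lambda>_. 1"]) (use assms in auto)
  note D0 = frechet_derivative_within_eq[OF acc mem this]
  have "(*) d = (\<lambda>h. 0)" using D D0 by (rule trans[OF sym])
  then have "d * 1 = 0" by (rule fun_cong)
  with d show ?thesis using DERIV_imp_deriv[of S d 0] by simp
qed

text \<open>
  Once \<open>\<theta> * u\<close> is recognised as the height gradient, flux and source agree by algebra. The second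
  component has zero flux, so its balance law is the ordinary differential equation for \<open>h\<^sub>s\<close>.
\<close>

lemma laser_balance_iff:
  assumes \<eta>: "CWk_on 2 UNIV \<eta>" and supp: "\<And>z. norm z > \<rho> \<Longrightarrow> \<eta> z = 0"
    and int: "\<And>t. t \<in> {0..T} \<Longrightarrow> locally_integrable (hm t) \<and> locally_integrable (hs t)"
  defines "u \<equiv> (\<lambda>t x. vector [hm t x, hs t x]) :: real \<Rightarrow> real^2 \<Rightarrow> real^2"
  shows "(\<forall>t\<in>{0..T}. \<forall>x.
           melt_flux w Tg \<eta> hm hs t x = laser_flux w Tg t x (u t x $ 1) (mconv (laser_kernel \<eta>) (u t) x) $ 1 \<and>
           0 = laser_flux w Tg t x (u t x $ 2) (mconv (laser_kernel \<eta>) (u t) x) $ 2 \<and>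
           melt_source i \<eta> hm hs t x = laser_source i t x (u t x $ 1) (mconv (laser_kernel \<eta>) (u t) x) $ 1 \<and>
           - melt_source i \<eta> hm hs t x = laser_source i t x (u t x $ 2) (mconv (laser_kernel \<eta>) (u t) x) $ 2)"
      (is ?match)
    and "laser_system T w i Tg \<eta> hm hs \<longleftrightarrow>
         nonlocal_balance_system T (laser_flux w Tg) (laser_source i) (laser_kernel \<eta>) u"
proof -
  have A: "mconv (laser_kernel \<eta>) (u t) x = height_grad \<eta> hm hs t x" if "t \<in> {0..T}" for t x
    using mconv_laser_kernel[OF \<eta> supp] int[OF that] by (simp add: u_def height_grad_def)
  show match: ?match
  proof (intro ballI allI)
    fix t x assume t: "t \<in> {0..T}"
    show "melt_flux w Tg \<eta> hm hs t x = laser_flux w Tg t x (u t x $ 1) (mconv (laser_kernel \<eta>) (u t) x) $ 1 \<and>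
       0 = laser_flux w Tg t x (u t x $ 2) (mconv (laser_kernel \<eta>) (u t) x) $ 2 \<and>
       melt_source i \<eta> hm hs t x = laser_source i t x (u t x $ 1) (mconv (laser_kernel \<eta>) (u t) x) $ 1 \<and>
       - melt_source i \<eta> hm hs t x = laser_source i t x (u t x $ 2) (mconv (laser_kernel \<eta>) (u t) x) $ 2"
      unfolding A[OF t]
      by (simp add: melt_flux_def melt_source_def laser_flux_def laser_source_def u_def
          algebra_simps power2_eq_square diff_divide_distrib)
  qed
  have cong: "balance_law T h P g \<longleftrightarrow> balance_law T h P' g'"
    if eq: "\<And>t x. t \<in> {0..T} \<Longrightarrow> P t x = P' t x \<and> g t x = g' t x"
    for h :: "real \<Rightarrow> real^2 \<Rightarrow> real" and P P' g g'
  proof -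
    have "P t = P' t" if "t \<in> {0..T}" for t using eq[OF that] by auto
    then show ?thesis using eq unfolding balance_law_def by (intro ball_cong) auto
  qed
  have zero: "balance_law T h (\<lambda>t x. 0) g \<longleftrightarrow>
      (\<forall>t\<in>{0..T}. \<forall>x. ((\<lambda>s. h s x) has_real_derivative g t x) (at t within {0..T}))"
    for h g :: "real \<Rightarrow> real^2 \<Rightarrow> real"
    by (auto simp: balance_law_def divergence_def)
  have "balance_law T hm (melt_flux w Tg \<eta> hm hs) (melt_source i \<eta> hm hs) \<longleftrightarrow>
      balance_law T hm (\<lambda>t x. laser_flux w Tg t x (u t x $ 1) (mconv (laser_kernel \<eta>) (u t) x) $ 1)
        (\<lambda>t x. laser_source i t x (u t x $ 1) (mconv (laser_kernel \<eta>) (u t) x) $ 1)"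
    using match by (intro cong) blast
  moreover have "balance_law T hs (\<lambda>t x. 0) (\<lambda>t x. - melt_source i \<eta> hm hs t x) \<longleftrightarrow>
      balance_law T hs (\<lambda>t x. laser_flux w Tg t x (u t x $ 2) (mconv (laser_kernel \<eta>) (u t) x) $ 2)
        (\<lambda>t x. laser_source i t x (u t x $ 2) (mconv (laser_kernel \<eta>) (u t) x) $ 2)"
    using match by (intro cong) blast
  moreover have "(\<lambda>t x. u t x $ 1) = hm" "(\<lambda>t x. u t x $ 2) = hs" by (auto simp: u_def)
  ultimately show "laser_system T w i Tg \<eta> hm hs \<longleftrightarrow>
         nonlocal_balance_system T (laser_flux w Tg) (laser_source i) (laser_kernel \<eta>) u"
    by (simp add: laser_system_def nonlocal_balance_system_def forall_2 zero)
qed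

theorem proposition3p1:
  fixes T \<tau>g r R :: real
    and xL :: "real \<Rightarrow> real^2"
    and W I S :: "real \<Rightarrow> real"
    and \<eta> :: "real^2 \<Rightarrow> real"
    and w i Tg :: "real \<Rightarrow> real^2 \<Rightarrow> real"
  assumes "0 < T" and "0 < r" and "r < R"
    and "CWk_on 2 {0..T} xL"
    and "Ck_compact_support 2 W" and "Ck_compact_support 2 I" and "Ck_compact_support 2 S"
    and "Ck_compact_support 3 \<eta>"
    and "(LINT x|lebesgue. \<eta> x) = 1"
    and "deriv W 0 = 0" and "deriv I 0 = 0"
    and "\<And>\<xi>. \<xi> \<in> {0..r} \<Longrightarrow> S \<xi> = 1"
    and "\<And>\<xi>. \<xi> \<ge> R \<Longrightarrow> S \<xi> = 0"
  defines "w \<equiv> \<lambda>t x. W (norm (x - xL t))"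
    and "i \<equiv> \<lambda>t x. I (norm (x - xL t))"
    and "Tg \<equiv> \<lambda>t x. \<tau>g * S (norm (x - xL t))"
  shows
    "(\<forall>hm hs :: real \<Rightarrow> real^2 \<Rightarrow> real.
        (\<forall>t\<in>{0..T}. locally_integrable (hm t) \<and> locally_integrable (hs t)) \<longrightarrow>
        (let u = (\<lambda>t x. vector [hm t x, hs t x]) :: real \<Rightarrow> real^2 \<Rightarrow> real^2;
             \<theta> = laser_kernel \<eta>; \<phi> = laser_flux w Tg; \<Phi> = laser_source i
         in (\<forall>t\<in>{0..T}. \<forall>x.
               melt_flux w Tg \<eta> hm hs t x = \<phi> t x (u t x $ 1) (mconv \<theta> (u t) x) $ 1 \<and>
               0 = \<phi> t x (u t x $ 2) (mconv \<theta> (u t) x) $ 2 \<and>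
               melt_source i \<eta> hm hs t x = \<Phi> t x (u t x $ 1) (mconv \<theta> (u t) x) $ 1 \<and>
               - melt_source i \<eta> hm hs t x = \<Phi> t x (u t x $ 2) (mconv \<theta> (u t) x) $ 2) \<and>
            (laser_system T w i Tg \<eta> hm hs \<longleftrightarrow> nonlocal_balance_system T \<phi> \<Phi> \<theta> u))) \<and>
     (\<exists>lam. admissible_bound T lam \<and>
        flux_assumption T lam (laser_flux w Tg) \<and>
        source_assumption T lam (laser_source i)) \<and>
     kernel_assumption (laser_kernel \<eta>)"
proof (intro conjI)
  obtain K\<eta> where "compact K\<eta>" and K\<eta>: "\<And>x. x \<notin> K\<eta> \<Longrightarrow> \<eta> x = 0" and C\<eta>: "CWk_on 3 UNIV \<eta>"
    using Ck_compact_supportD[OF assms(8)] by blast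
  obtain \<rho>\<eta> where "\<And>x. x \<in> K\<eta> \<Longrightarrow> norm x \<le> \<rho>\<eta>"
    using compact_imp_bounded[OF \<open>compact K\<eta>\<close>] by (auto simp: bounded_iff)
  then have supp: "\<eta> z = 0" if "norm z > \<rho>\<eta>" for z using K\<eta> that by force
  have \<eta>: "CWk_on 2 UNIV \<eta>" using C\<eta> by (rule CWk_on_mono) simp
  show "\<forall>hm hs :: real \<Rightarrow> real^2 \<Rightarrow> real.
        (\<forall>t\<in>{0..T}. locally_integrable (hm t) \<and> locally_integrable (hs t)) \<longrightarrow>
        (let u = (\<lambda>t x. vector [hm t x, hs t x]) :: real \<Rightarrow> real^2 \<Rightarrow> real^2;
             \<theta> = laser_kernel \<eta>; \<phi> = laser_flux w Tg; \<Phi> = laser_source i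
         in (\<forall>t\<in>{0..T}. \<forall>x.
               melt_flux w Tg \<eta> hm hs t x = \<phi> t x (u t x $ 1) (mconv \<theta> (u t) x) $ 1 \<and>
               0 = \<phi> t x (u t x $ 2) (mconv \<theta> (u t) x) $ 2 \<and>
               melt_source i \<eta> hm hs t x = \<Phi> t x (u t x $ 1) (mconv \<theta> (u t) x) $ 1 \<and>
               - melt_source i \<eta> hm hs t x = \<Phi> t x (u t x $ 2) (mconv \<theta> (u t) x) $ 2) \<and>
            (laser_system T w i Tg \<eta> hm hs \<longleftrightarrow> nonlocal_balance_system T \<phi> \<Phi> \<theta> u))"
    unfolding Let_def by (intro allI impI conjI laser_balance_iff[OF \<eta> supp]) blast+
  show "kernel_assumption (laser_kernel \<eta>)" by (rule kernel_assumption_laser_kernel[OF assms(8)])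
  have "S differentiable (at 0)"
    using assms(7) by (simp add: Ck_compact_support_def numeral_2_eq_2)
  then have S0: "deriv S 0 = 0" using deriv_eq_0_if_const_right[of r S] assms(2,12) by blast
  obtain \<rho>w where Gw: "CWk_on 2 UNIV (\<lambda>x::real^2. W (norm x))"
    "\<And>x::real^2. norm x > \<rho>w \<Longrightarrow> W (norm x) = 0"
    using Ck_compact_support_radial[OF assms(5,10)] by blast
  obtain \<rho>i where Gi: "CWk_on 2 UNIV (\<lambda>x::real^2. I (norm x))"
    "\<And>x::real^2. norm x > \<rho>i \<Longrightarrow> I (norm x) = 0"
    using Ck_compact_support_radial[OF assms(6,11)] by blast
  obtain \<rho>s where Gs: "CWk_on 2 UNIV (\<lambda>x::real^2. S (norm x))"
    "\<And>x::real^2. norm x > \<rho>s \<Longrightarrow> S (norm x) = 0"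
    using Ck_compact_support_radial[OF assms(7) S0] by blast
  have G\<tau>: "CWk_on 2 UNIV (\<lambda>x::real^2. \<tau>g * S (norm x))"
    by (rule CWk_on_linear[OF bounded_linear_mult_right axis_accessible_UNIV Gs(1)])
  define \<rho> where "\<rho> = max \<rho>w (max \<rho>i \<rho>s)"
  have out: "W (norm z) = 0" "I (norm z) = 0" "\<tau>g * S (norm z) = 0" if "norm z > \<rho>" for z :: "real^2"
    using that Gw(2) Gi(2) Gs(2) by (auto simp: \<rho>_def)
  obtain \<sigma> where \<sigma>: "\<And>t. t \<in> {0..T} \<Longrightarrow> norm (xL t) \<le> \<sigma>"
    using CWk_on_imp_bounded[OF assms(4)] unfolding bounded_iff by (metis imageI)
  let ?lam = "\<lambda>K t (x::real^2) U. K * (1 + U + U\<^sup>2) * cutoff (\<rho> + \<sigma>) x"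
  obtain K1 where K1: "K1 \<ge> 0" "\<And>K. K \<ge> K1 \<Longrightarrow> flux_assumption T (?lam K) (laser_flux w Tg)"
    using flux_assumption_laser_flux[OF assms(1,4) \<sigma> Gw(1) out(1) G\<tau> out(3)]
    unfolding w_def Tg_def by blast
  obtain K2 where K2: "K2 \<ge> 0" "\<And>K. K \<ge> K2 \<Longrightarrow> source_assumption T (?lam K) (laser_source i)"
    using source_assumption_laser_source[OF assms(1,4) \<sigma> Gi(1) out(2)]
    unfolding i_def by blast
  have "admissible_bound T (?lam (max K1 K2))" using K1(1) by (intro admissible_bound_cutoff) simp
  then show "\<exists>lam. admissible_bound T lam \<and> flux_assumption T lam (laser_flux w Tg) \<and>
      source_assumption T lam (laser_source i)"
    using K1(2)[of "max K1 K2"] K2(2)[of "max K1 K2"] by (intro exI[of _ "?lam (max K1 K2)"]) simp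
qed

end
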